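(* Let $n,m\ge 2$ be integers and $\lambda_1,\lambda_2\in(0,1)$. Let $Q_{[1]}=(\lambda_1^{|i-j|})_{i,j=1}^n\in\mathbb{R}^{n\times n}$ and $Q_{[2]}=(\lambda_2^{|i-j|})_{i,j=1}^m\in\mathbb{R}^{m\times m}$, let $L_{[1]}$ and $L_{[2]}$ be the strictly lower triangular parts of $Q_{[1]}$ and $Q_{[2]}$ respectively, and let $Q=Q_{[2]}\otimes Q_{[1]}\in\mathbb{R}^{nm\times nm}$ be the two-dimensional Wasserstein-1 metric matrix. Put $$m_1=\min\left\{1+2\|L_{[1]}\|_2,\ \frac{3-\lambda_1}{1-\lambda_1},\ \frac{2(1+\lambda_1)(1-\lambda_1^{n-1})}{1-\lambda_1}\right\},\qquad m_2=\min\left\{1+2\|L_{[2]}\|_2,\ \frac{3-\lambda_2}{1-\lambda_2},\ \frac{2(1+\lambda_2)(1-\lambda_2^{m-1})}{1-\lambda_2}\right\}.$$ Then the following hold: (i) If $\lambda_1,\lambda_2\le\frac13$, then every eigenvalue $\alpha$ of $Q$ satisfies $0<\alpha<4$. (ii) Every eigenvalue $\alpha$ of $Q$ satisfies $0<\alpha\le \left(1+2\|L_{[1]}\|_2\cos\left(\frac{\pi}{n+1}\right)\right)\left(1+2\|L_{[2]}\|_2\cos\left(\frac{\pi}{m+1}\right)\right)$. (iii) $\rho(Q)\ge(1+\lambda_1)(1+\lambda_2)$. (iv) $W(Q)\subset\left(0,\ \frac{(1+\lambda_1)(1+\lambda_2)(1-\lambda_1^{n-1})(1-\lambda_2^{m-1})}{(1-\lambda_1)(1-\lambda_2)}\right]$.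 (v) $\frac{1}{(1+\lambda_1)^2(1+\lambda_2)^2}\le\|Q\|_1=\|Q\|_\infty\le\left(1+\frac{2\lambda_1(1-\lambda_1^{n-1})}{1-\lambda_1}\right)\left(1+\frac{2\lambda_2(1-\lambda_2^{m-1})}{1-\lambda_2}\right)$. (vi) $\frac{1}{(1+\lambda_1)^2(1+\lambda_2)^2}\le\|Q\|_2\le m_1m_2$. (vii) $\|Q^{-1}\|_1=\|Q^{-1}\|_\infty\ge\frac{(1-\lambda_1)(1-\lambda_2)}{(1+\lambda_1)(1+\lambda_2)(1-\lambda_1^n)^2(1-\lambda_2^m)^2}$. (viii) $\frac{(1-\lambda_1)(1-\lambda_2)}{(1+\lambda_1)(1+\lambda_2)}\le\|Q^{-1}\|_2\le\frac{(1+\lambda_1)(1+\lambda_2)}{(1-\lambda_1)(1-\lambda_2)}$. (ix) $\frac{(1-\lambda_1)(1-\lambda_2)}{(1+\lambda_1)^3(1+\lambda_2)^3(1-\lambda_1^n)^2(1-\lambda_2^m)^2}\le\kappa_1(Q)=\kappa_\infty(Q)\le\frac{(1+\lambda_1)(1+\lambda_2)\left(1-\lambda_1+2\lambda_1(1-\lambda_1^{n-1})\right)\left(1-\lambda_2+2\lambda_2(1-\lambda_2^{m-1})\right)}{(1-\lambda_1)^2(1-\lambda_2)^2}$. (x) $\frac{(1-\lambda_1)(1-\lambda_2)}{(1+\lambda_1)^3(1+\lambda_2)^3}\le\kappa_2(Q)\le m_1m_2\cdot\frac{(1+\lambda_1)(1+\lambda_2)}{(1-\lambda_1)(1-\lam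bda_2)}$.
   Context: $\otimes$ is the Kronecker product. Each $Q_{[k]}$ ($k=1,2$) is a one-dimensional Wasserstein-1 metric matrix and is known to be symmetric positive definite; hence $Q$ is symmetric positive definite and invertible. $L_{[k]}$ has $(i,j)$ entry $\lambda_k^{i-j}$ for $i>j$ and $0$ otherwise, so $Q_{[k]}=I+L_{[k]}+L_{[k]}^T$. $\|\cdot\|_1,\|\cdot\|_2,\|\cdot\|_\infty$ are the induced operator norms (maximum absolute column sum, spectral norm, maximum absolute row sum). For $\#\in\{1,2,\infty\}$ and $A$ nonsingular, $\kappa_\#(A)=\|A\|_\#\|A^{-1}\|_\#$. $\rho(A)$ is the spectral radius, and $W(A)=\{x^*Ax: x \text{ a complex vector},\ \|x\|_2=1\}$ is the numerical range. *)

theory Defs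
  imports
    "Jordan_Normal_Form.Spectral_Radius"
    "Jordan_Normal_Form.Gauss_Jordan_Elimination"
    "Jordan_Normal_Form.Conjugate"
    Complex_Main
begin

definition wass_mat :: "real \<Rightarrow> nat \<Rightarrow> real mat" where
  "wass_mat lam n = mat n n (\<lambda>(i, j). lam ^ nat \<bar>int i - int j\<bar>)"

definition strict_lower :: "'a :: zero mat \<Rightarrow> 'a mat" where
  "strict_lower A = mat (dim_row A) (dim_col A) (\<lambda>(i, j). if j < i then A $$ (i, j) else 0)"

definition kronecker :: "'a :: times mat \<Rightarrow> 'a mat \<Rightarrow> 'a mat" where
  "kronecker A B = mat (dim_row A * dim_row B) (dim_col A * dim_col B)
     (\<lambda>(i, j). A $$ (i div dim_row B, j div dim_col B) * B $$ (i mod dim_row B, j mod dim_col B))"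

definition vec_norm1 :: "'a :: real_normed_vector vec \<Rightarrow> real" where
  "vec_norm1 x = (\<Sum>i<dim_vec x. norm (x $ i))"

definition vec_norm2 :: "'a :: real_normed_vector vec \<Rightarrow> real" where
  "vec_norm2 x = sqrt (\<Sum>i<dim_vec x. (norm (x $ i))\<^sup>2)"

(* Only meaningful in positive dimension, because Max {} is unspecified. *)
definition vec_norm_inf :: "'a :: real_normed_vector vec \<Rightarrow> real" where
  "vec_norm_inf x = Max ((\<lambda>i. norm (x $ i)) ` {..<dim_vec x})"

(* The operator norm induced by the vector norm N. *)
definition op_norm :: "(real vec \<Rightarrow> real) \<Rightarrow> real mat \<Rightarrow> real" where
  "op_norm N A = (SUP x \<in> carrier_vec (dim_col A) - {0\<^sub>v (dim_col A)}. N (A *\<^sub>v x) / N x)"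

(* mat_inverse returns an option; for a singular A the value below is unspecified. *)
definition mat_inv :: "'a :: field mat \<Rightarrow> 'a mat" where
  "mat_inv A = the (mat_inverse A)"

definition cond_num :: "(real vec \<Rightarrow> real) \<Rightarrow> real mat \<Rightarrow> real" where
  "cond_num N A = op_norm N A * op_norm N (mat_inv A)"

(* The scalar product v \<bullet>c w conjugates its second argument, so (A *\<^sub>v x) \<bullet>c x is x^* A x. *)
definition numerical_range :: "complex mat \<Rightarrow> complex set" where
  "numerical_range A =
     {(A *\<^sub>v x) \<bullet>c x | x. x \<in> carrier_vec (dim_row A) \<and> vec_norm2 x = 1}"

lemma mat_inv_eq:
  fixes A B :: "'a :: field mat"
  assumes A: "A \<in> carrier_mat n n" and B: "B \<in> carrier_mat n n" and AB: "A * B = 1\<^sub>m n"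
  shows "mat_inv A = B"
proof -
  have BA: "B * A = 1\<^sub>m n"
    using mat_mult_left_right_inverse[OF A B AB] .
  have "A \<in> Units (ring_mat TYPE('a) n ())"
    using A B AB BA by (auto simp: Units_def ring_mat_def)
  then obtain C where C: "mat_inverse A = Some C"
    using mat_inverse(1)[OF A, where b = "()"] by (cases "mat_inverse A") auto
  have CA: "C * A = 1\<^sub>m n" and Cc: "C \<in> carrier_mat n n"
    using mat_inverse(2)[OF A C] by auto
  have "C = C * (A * B)" using Cc AB by simp
  also have "\<dots> = (C * A) * B" using assoc_mult_mat[OF Cc A B] by simp
  also have "\<dots> = B" using CA B by simp
  finally show ?thesis using C by (simp add: mat_inv_def)
qed

(* The norms induced by the 1-norm and the maximum norm are the maximum absolute
   column sum and the maximum absolute row sum. *)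

lemma op_norm1_eq_max_col_sum:
  assumes "dim_col A > 0"
  shows "op_norm vec_norm1 A = Max ((\<lambda>j. \<Sum>i<dim_row A. \<bar>A $$ (i, j)\<bar>) ` {..<dim_col A})"
    (is "_ = ?M")
proof -
  let ?n = "dim_col A"
  let ?S = "carrier_vec ?n - {0\<^sub>v ?n} :: real vec set"
  have col_le: "(\<Sum>i<dim_row A. \<bar>A $$ (i, j)\<bar>) \<le> ?M" if "j < ?n" for j
    using that by (intro Max_ge) auto
  have "?M \<in> (\<lambda>j. \<Sum>i<dim_row A. \<bar>A $$ (i, j)\<bar>) ` {..<?n}"
    using assms by (intro Max_in) auto
  then obtain j0 where j0: "j0 < ?n" "?M = (\<Sum>i<dim_row A. \<bar>A $$ (i, j0)\<bar>)" by auto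
  show ?thesis unfolding op_norm_def
  proof (rule cSup_eq_maximum)
    have "(A *\<^sub>v unit_vec ?n j0) $ i = A $$ (i, j0)" if "i < dim_row A" for i
      using that j0(1) by simp
    then have "vec_norm1 (A *\<^sub>v unit_vec ?n j0) = ?M"
      unfolding vec_norm1_def j0(2) by (simp del: index_mult_mat_vec)
    moreover have "vec_norm1 (unit_vec ?n j0 :: real vec) = (\<Sum>i<?n. if i = j0 then 1 else 0)"
      unfolding vec_norm1_def by (intro sum.cong) (use j0(1) in auto)
    then have "vec_norm1 (unit_vec ?n j0 :: real vec) = 1"
      using j0(1) by simp
    moreover have "unit_vec ?n j0 \<in> ?S" using j0(1) unit_vec_nonzero by auto
    ultimately show "?M \<in> (\<lambda>x. vec_norm1 (A *\<^sub>v x) / vec_norm1 x) ` ?S"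
      by (intro image_eqI[of _ _ "unit_vec ?n j0"]) auto
  next
    fix r assume "r \<in> (\<lambda>x. vec_norm1 (A *\<^sub>v x) / vec_norm1 x) ` ?S"
    then obtain x where x: "x \<in> carrier_vec ?n" "x \<noteq> 0\<^sub>v ?n"
      and r: "r = vec_norm1 (A *\<^sub>v x) / vec_norm1 x" by auto
    from x obtain k where k: "k < ?n" "x $ k \<noteq> 0"
      by (metis carrier_vecD eq_vecI index_zero_vec)
    have pos: "vec_norm1 x > 0"
      unfolding vec_norm1_def using x(1) k by (intro sum_pos2[of _ k]) auto
    have "vec_norm1 (A *\<^sub>v x) \<le> (\<Sum>i<dim_row A. \<Sum>j<?n. \<bar>A $$ (i, j)\<bar> * \<bar>x $ j\<bar>)"
      unfolding vec_norm1_def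
      using x(1) by (auto intro!: sum_mono order.trans[OF sum_abs]
          simp: scalar_prod_def abs_mult lessThan_atLeast0)
    also have "\<dots> = (\<Sum>j<?n. (\<Sum>i<dim_row A. \<bar>A $$ (i, j)\<bar>) * \<bar>x $ j\<bar>)"
      by (subst sum.swap) (simp add: sum_distrib_right)
    also have "\<dots> \<le> (\<Sum>j<?n. ?M * \<bar>x $ j\<bar>)"
      by (intro sum_mono mult_right_mono col_le) auto
    also have "\<dots> = ?M * vec_norm1 x"
      using x(1) by (simp add: vec_norm1_def sum_distrib_left)
    finally show "r \<le> ?M" using pos by (simp add: r field_simps)
  qed
qed

lemma op_norm_inf_eq_max_row_sum:
  assumes "dim_row A > 0" "dim_col A > 0"
  shows "op_norm vec_norm_inf A = Max ((\<lambda>i. \<Sum>j<dim_col A. \<bar>A $$ (i, j)\<bar>) ` {..<dim_row A})"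
    (is "_ = ?M")
proof -
  let ?n = "dim_col A"
  let ?S = "carrier_vec ?n - {0\<^sub>v ?n} :: real vec set"
  have row_le: "(\<Sum>j<?n. \<bar>A $$ (i, j)\<bar>) \<le> ?M" if "i < dim_row A" for i
    using that by (intro Max_ge) auto
  have "?M \<in> (\<lambda>i. \<Sum>j<?n. \<bar>A $$ (i, j)\<bar>) ` {..<dim_row A}"
    using assms by (intro Max_in) auto
  then obtain i0 where i0: "i0 < dim_row A" "?M = (\<Sum>j<?n. \<bar>A $$ (i0, j)\<bar>)" by auto
  have upper: "vec_norm_inf (A *\<^sub>v x) \<le> ?M * vec_norm_inf x" if x: "x \<in> carrier_vec ?n" for x
  proof -
    have xj: "\<bar>x $ j\<bar> \<le> vec_norm_inf x" if "j < ?n" for j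
      unfolding vec_norm_inf_def using that x by (intro Max_ge) auto
    have nn: "0 \<le> vec_norm_inf x" using xj[OF assms(2)] by linarith
    have "norm ((A *\<^sub>v x) $ i) \<le> ?M * vec_norm_inf x" if i: "i < dim_row A" for i
    proof -
      have "norm ((A *\<^sub>v x) $ i) \<le> (\<Sum>j<?n. \<bar>A $$ (i, j)\<bar> * \<bar>x $ j\<bar>)"
        using x i by (auto intro!: order.trans[OF sum_abs]
            simp: scalar_prod_def abs_mult lessThan_atLeast0)
      also have "\<dots> \<le> (\<Sum>j<?n. \<bar>A $$ (i, j)\<bar> * vec_norm_inf x)"
        by (intro sum_mono mult_left_mono xj) auto
      also have "\<dots> = (\<Sum>j<?n. \<bar>A $$ (i, j)\<bar>) * vec_norm_inf x"
        by (simp add: sum_distrib_right)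
      also have "\<dots> \<le> ?M * vec_norm_inf x"
        by (rule mult_right_mono[OF row_le[OF i] nn])
      finally show ?thesis .
    qed
    then show ?thesis
      unfolding vec_norm_inf_def[of "A *\<^sub>v x"] using assms(1)
      by (subst Max_le_iff) auto
  qed
  show ?thesis unfolding op_norm_def
  proof (rule cSup_eq_maximum)
    define s where "s = vec ?n (\<lambda>j. if A $$ (i0, j) < 0 then - 1 else 1 :: real)"
    have s: "s \<in> carrier_vec ?n" by (simp add: s_def)
    have "s $ 0 \<noteq> 0" using assms(2) by (simp add: s_def)
    then have "s \<noteq> 0\<^sub>v ?n" using assms(2) by auto
    have "(\<lambda>j. norm (s $ j)) ` {..<dim_vec s} = {1}"
      using assms(2) by (force simp: s_def image_iff)
    then have s1: "vec_norm_inf s = 1" by (simp add: vec_norm_inf_def)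
    have "(A *\<^sub>v s) $ i0 = (\<Sum>j<?n. \<bar>A $$ (i0, j)\<bar>)"
      using i0(1) by (auto simp: s_def scalar_prod_def lessThan_atLeast0 intro!: sum.cong)
    moreover have "norm ((A *\<^sub>v s) $ i0) \<le> vec_norm_inf (A *\<^sub>v s)"
      unfolding vec_norm_inf_def using i0(1) by (intro Max_ge) auto
    ultimately have "?M \<le> vec_norm_inf (A *\<^sub>v s)" using i0(2) by auto
    with upper[OF s] s1 have "vec_norm_inf (A *\<^sub>v s) / vec_norm_inf s = ?M" by simp
    then show "?M \<in> (\<lambda>x. vec_norm_inf (A *\<^sub>v x) / vec_norm_inf x) ` ?S"
      using s \<open>s \<noteq> 0\<^sub>v ?n\<close> by (intro image_eqI[of _ _ s]) auto
  next
    fix r assume "r \<in> (\<lambda>x. vec_norm_inf (A *\<^sub>v x) / vec_norm_inf x) ` ?S"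
    then obtain x where x: "x \<in> carrier_vec ?n" "x \<noteq> 0\<^sub>v ?n"
      and r: "r = vec_norm_inf (A *\<^sub>v x) / vec_norm_inf x" by auto
    from x obtain k where k: "k < ?n" "x $ k \<noteq> 0"
      by (metis carrier_vecD eq_vecI index_zero_vec)
    have "norm (x $ k) \<le> vec_norm_inf x"
      unfolding vec_norm_inf_def using k(1) x(1) by (intro Max_ge) auto
    with k(2) have "vec_norm_inf x > 0" by (smt (verit) real_norm_def)
    with upper[OF x(1)] show "r \<le> ?M" by (simp add: r field_simps)
  qed
qed

end

(* The inverse of each factor is tridiagonal with maximal absolute row sum (1 + lam) / (1 - lam).
   The Schur test turns row sums of symmetric matrices into bounds for the spectral norm, and both
   row sums and spectral norm bounds are multiplicative under the Kronecker product. The bound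
   1 + 2 ||L||_2 cos (pi / (n + 1)) for one factor Q = 1 + L + L^T is the Haagerup--de la Harpe
   estimate for the numerical radius of the nilpotent matrix L. Positivity comes from a Cholesky
   factorization of each factor. For the spectral radius from below, a Rayleigh quotient r of a
   symmetric matrix forces its powers to grow like r^k, whereas powers stay bounded
   when the spectral radius is less than 1. *)

theory Submission
  imports Defs
begin

text \<open>One-sided bounds on the quadratic forms of symmetric matrices do not multiply under the
  Kronecker product (two very negative eigenvalues have a large positive product), whereas norm
  bounds do. So upper bounds for the factors are carried as norm bounds, by \<open>l2_bound\<close>,
  and a form bound for \<open>Q\<close> is extracted only at the end. Row sums give norm bounds at
  once; the cosine estimate bounds only a form, and the Gram factorization of each factor upgrades
  it. The row-sum constant (1 + lam)(1 - lam^(n-1)) / (1 - lam) of each factor is behind (i), (iv),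
  the upper bound in (v), and the last two entries of each minimum in (vi). The lower bounds on the
  norms need a single entry: \<open>Q\<close> has entry 1 at (0, 0), and the inverse has the product
  of the numbers 1 / (1 - lam^2) there. Each claimed constant is at most that entry. Bounding the
  spectral radius through growth of powers avoids any diagonalization of \<open>Q\<close>.\<close>

section \<open>Spectral norm of real matrices\<close>

text \<open>Besides the Euclidean case it is applied to the defect form of a contraction, where only
  nonnegativity is known and the leading coefficient may vanish.\<close>

lemma nonneg_quadratic_discriminant:
  fixes a b c :: real
  assumes "\<And>s. 0 \<le> a + 2 * b * s + c * s\<^sup>2" and "0 \<le> c"
  shows "b\<^sup>2 \<le> a * c"
proof (cases "c = 0")
  case True
  have "b = 0"
  proof (rule ccontr)
    assume "b \<noteq> 0"
    \<comment> \<open>With \<open>c = 0\<close>, this value of \<open>s\<close> makes the expression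
      equal to -1.\<close>
    then show False using assms(1)[of "- (a + 1) / (2 * b)"] True by simp
  qed
  then show ?thesis using True by simp
next
  case False
  have "0 \<le> a + 2 * b * (- b / c) + c * (- b / c)\<^sup>2" by (rule assms(1))
  also have "\<dots> = (a * c - b\<^sup>2) / c" using False by (simp add: field_simps power2_eq_square)
  finally show ?thesis using False assms(2) by (simp add: zero_le_divide_iff)
qed

lemma Cauchy_Schwarz_real_sum:
  fixes f g :: "'a \<Rightarrow> real"
  shows "(\<Sum>i\<in>A. f i * g i)\<^sup>2 \<le> (\<Sum>i\<in>A. (f i)\<^sup>2) * (\<Sum>i\<in>A. (g i)\<^sup>2)"
proof (rule nonneg_quadratic_discriminant)
  fix s :: real
  have "0 \<le> (\<Sum>i\<in>A. (f i + s * g i)\<^sup>2)" by (simp add: sum_nonneg)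
  also have "\<dots> = (\<Sum>i\<in>A. (f i)\<^sup>2) + 2 * (\<Sum>i\<in>A. f i * g i) * s + (\<Sum>i\<in>A. (g i)\<^sup>2) * s\<^sup>2"
    by (simp add: power2_eq_square algebra_simps sum.distrib sum_distrib_left sum_distrib_right)
  finally show "0 \<le> \<dots>" .
qed (simp add: sum_nonneg)

lemma scalar_prod_self_nonneg: "0 \<le> x \<bullet> (x :: real vec)"
  by (simp add: scalar_prod_def sum_nonneg)

lemma scalar_prod_self_eq_0_iff:
  fixes x :: "real vec"
  assumes "x \<in> carrier_vec n"
  shows "x \<bullet> x = 0 \<longleftrightarrow> x = 0\<^sub>v n"
proof
  assume "x \<bullet> x = 0"
  then have "\<forall>i\<in>{0..<n}. x $ i * x $ i = 0"
    using assms by (subst (asm) scalar_prod_def, subst (asm) sum_nonneg_eq_0_iff) auto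
  then show "x = 0\<^sub>v n" using assms by (intro eq_vecI) auto
qed simp

lemma scalar_prod_Cauchy_Schwarz:
  fixes x y :: "real vec"
  assumes "x \<in> carrier_vec n" "y \<in> carrier_vec n"
  shows "(x \<bullet> y)\<^sup>2 \<le> (x \<bullet> x) * (y \<bullet> y)"
  using Cauchy_Schwarz_real_sum[of "($) x" "($) y" "{0..<n}"] assms
  by (simp add: scalar_prod_def power2_eq_square)

lemma vec_norm2_real: "vec_norm2 (x :: real vec) = sqrt (x \<bullet> x)"
  by (simp add: vec_norm2_def scalar_prod_def power2_eq_square lessThan_atLeast0)

text \<open>The squared form avoids roots and lets bounds multiply without sign conditions.
  Nonnegativity of \<open>c\<close> is asked for separately where a bound on a norm or a form is
  extracted.\<close>

definition l2_bound :: "real mat \<Rightarrow> real \<Rightarrow> bool" where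
  "l2_bound A c \<longleftrightarrow>
     (\<forall>x \<in> carrier_vec (dim_col A). (A *\<^sub>v x) \<bullet> (A *\<^sub>v x) \<le> c\<^sup>2 * (x \<bullet> x))"

lemma l2_boundD:
  assumes "l2_bound A c" "A \<in> carrier_mat p q" "x \<in> carrier_vec q"
  shows "(A *\<^sub>v x) \<bullet> (A *\<^sub>v x) \<le> c\<^sup>2 * (x \<bullet> x)"
  using assms by (auto simp: l2_bound_def)

lemma l2_bound_vec_norm2:
  assumes "l2_bound A c" "0 \<le> c" "x \<in> carrier_vec (dim_col A)"
  shows "vec_norm2 (A *\<^sub>v x) \<le> c * vec_norm2 x"
proof -
  have "sqrt ((A *\<^sub>v x) \<bullet> (A *\<^sub>v x)) \<le> sqrt (c\<^sup>2 * (x \<bullet> x))"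
    using assms by (simp add: l2_bound_def)
  also have "\<dots> = c * sqrt (x \<bullet> x)" using assms(2) by (simp add: real_sqrt_mult)
  finally show ?thesis by (simp add: vec_norm2_real)
qed

lemma vec_norm2_pos:
  fixes x :: "real vec"
  assumes "x \<in> carrier_vec n" "x \<noteq> 0\<^sub>v n"
  shows "vec_norm2 x > 0"
  using assms scalar_prod_self_eq_0_iff[OF assms(1)] scalar_prod_self_nonneg[of x]
  by (simp add: vec_norm2_real)

lemma op_norm2_le:
  assumes "l2_bound A c" "0 \<le> c" "dim_col A > 0"
  shows "op_norm vec_norm2 A \<le> c"
  unfolding op_norm_def
proof (rule cSUP_least)
  have "unit_vec (dim_col A) 0 \<in> carrier_vec (dim_col A) - {0\<^sub>v (dim_col A) :: real vec}"
    using assms(3) by auto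
  then show "carrier_vec (dim_col A) - {0\<^sub>v (dim_col A)} \<noteq> ({} :: real vec set)" by blast
next
  fix x :: "real vec" assume x: "x \<in> carrier_vec (dim_col A) - {0\<^sub>v (dim_col A)}"
  then have "vec_norm2 x > 0" by (intro vec_norm2_pos) auto
  then show "vec_norm2 (A *\<^sub>v x) / vec_norm2 x \<le> c"
    using l2_bound_vec_norm2[OF assms(1,2), of x] x by (simp add: divide_le_eq)
qed

text \<open>Supplies some finite bound, so that the \<open>SUP\<close> in \<open>op_norm\<close> is
  taken over a set that is bounded above and really is an upper bound of the quotients.\<close>

lemma l2_bound_Frobenius:
  "l2_bound A (sqrt (\<Sum>i<dim_row A. \<Sum>j<dim_col A. (A $$ (i, j))\<^sup>2))"
  unfolding l2_bound_def
proof
  fix x :: "real vec" assume x: "x \<in> carrier_vec (dim_col A)"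
  have "(A *\<^sub>v x) \<bullet> (A *\<^sub>v x) = (\<Sum>i<dim_row A. (\<Sum>j<dim_col A. A $$ (i, j) * x $ j)\<^sup>2)"
    using x by (simp add: scalar_prod_def power2_eq_square lessThan_atLeast0)
  also have "\<dots> \<le> (\<Sum>i<dim_row A. (\<Sum>j<dim_col A. (A $$ (i, j))\<^sup>2) * (x \<bullet> x))"
    using x Cauchy_Schwarz_real_sum[of _ "($) x" "{..<dim_col A}"]
    by (intro sum_mono) (simp add: scalar_prod_def power2_eq_square lessThan_atLeast0)
  also have "\<dots> = (sqrt (\<Sum>i<dim_row A. \<Sum>j<dim_col A. (A $$ (i, j))\<^sup>2))\<^sup>2 * (x \<bullet> x)"
    by (simp add: sum_nonneg sum_distrib_right)
  finally show "(A *\<^sub>v x) \<bullet> (A *\<^sub>v x) \<le> \<dots>" .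
qed

lemma vec_norm2_le_op_norm2:
  assumes "x \<in> carrier_vec (dim_col A)"
  shows "vec_norm2 (A *\<^sub>v x) \<le> op_norm vec_norm2 A * vec_norm2 x"
proof (cases "x = 0\<^sub>v (dim_col A)")
  case True
  then have "vec_norm2 x = 0" by (simp add: vec_norm2_real)
  then show ?thesis
    using l2_bound_vec_norm2[OF l2_bound_Frobenius _ assms] by (simp add: sum_nonneg)
next
  case False
  let ?S = "carrier_vec (dim_col A) - {0\<^sub>v (dim_col A)} :: real vec set"
  let ?c = "sqrt (\<Sum>i<dim_row A. \<Sum>j<dim_col A. (A $$ (i, j))\<^sup>2)"
  have "vec_norm2 (A *\<^sub>v x) / vec_norm2 x \<le> op_norm vec_norm2 A"
    unfolding op_norm_def
  proof (rule cSUP_upper)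
    show "x \<in> ?S" using assms False by simp
    show "bdd_above ((\<lambda>x. vec_norm2 (A *\<^sub>v x) / vec_norm2 x) ` ?S)"
    proof (rule bdd_aboveI2)
      fix y assume y: "y \<in> ?S"
      then have "vec_norm2 y > 0" by (intro vec_norm2_pos) auto
      then show "vec_norm2 (A *\<^sub>v y) / vec_norm2 y \<le> ?c"
        using l2_bound_vec_norm2[OF l2_bound_Frobenius, where x = y] y
        by (simp add: divide_le_eq sum_nonneg)
    qed
  qed
  then show ?thesis using vec_norm2_pos[OF assms False] by (simp add: divide_le_eq)
qed

text \<open>With no columns the supremum would range over the empty set; otherwise a unit vector has
  positive norm and fixes the sign.\<close>

lemma op_norm2_nonneg:
  assumes "dim_col A > 0"
  shows "0 \<le> op_norm vec_norm2 A"
proof -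
  let ?u = "unit_vec (dim_col A) 0 :: real vec"
  have "0 < vec_norm2 ?u" using assms by (intro vec_norm2_pos[of _ "dim_col A"]) auto
  moreover have "0 \<le> vec_norm2 (A *\<^sub>v ?u)" by (simp add: vec_norm2_def sum_nonneg)
  ultimately show ?thesis
    using vec_norm2_le_op_norm2[of ?u A] by (simp add: zero_le_mult_iff order_trans)
      (smt (verit) mult_neg_pos)
qed

lemma l2_bound_op_norm2: "l2_bound A (op_norm vec_norm2 A)"
  unfolding l2_bound_def
proof
  fix x :: "real vec" assume x: "x \<in> carrier_vec (dim_col A)"
  have "(vec_norm2 (A *\<^sub>v x))\<^sup>2 \<le> (op_norm vec_norm2 A * vec_norm2 x)\<^sup>2"
    using vec_norm2_le_op_norm2[OF x]
    by (intro power_mono) (auto simp: vec_norm2_def sum_nonneg)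
  then show "(A *\<^sub>v x) \<bullet> (A *\<^sub>v x) \<le> (op_norm vec_norm2 A)\<^sup>2 * (x \<bullet> x)"
    by (simp add: vec_norm2_real power_mult_distrib scalar_prod_self_nonneg)
qed

lemma l2_bound_quadratic:
  assumes "l2_bound A c" "0 \<le> c" "A \<in> carrier_mat n n" "x \<in> carrier_vec n"
  shows "x \<bullet> (A *\<^sub>v x) \<le> c * (x \<bullet> x)"
proof (rule power2_le_imp_le)
  have "(x \<bullet> (A *\<^sub>v x))\<^sup>2 \<le> (x \<bullet> x) * ((A *\<^sub>v x) \<bullet> (A *\<^sub>v x))"
    using assms by (intro scalar_prod_Cauchy_Schwarz) auto
  also have "\<dots> \<le> (x \<bullet> x) * (c\<^sup>2 * (x \<bullet> x))"
    using assms by (intro mult_left_mono l2_boundD scalar_prod_self_nonneg)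
  finally show "(x \<bullet> (A *\<^sub>v x))\<^sup>2 \<le> (c * (x \<bullet> x))\<^sup>2"
    by (simp add: power2_eq_square algebra_simps)
qed (simp add: assms(2) scalar_prod_self_nonneg)

text \<open>Schur test: Cauchy--Schwarz with weights |A_ij| bounds each squared component by a row
  sum times a weighted sum of squares. Summing over i then produces column sums, which symmetry
  turns back into row sums, hence the second factor \<open>r\<close>.\<close>

lemma l2_bound_symmetric_row_sum:
  assumes A: "A \<in> carrier_mat n n" and sym: "\<And>i j. i < n \<Longrightarrow> j < n \<Longrightarrow> A $$ (i, j) = A $$ (j, i)"
    and row: "\<And>i. i < n \<Longrightarrow> (\<Sum>j<n. \<bar>A $$ (i, j)\<bar>) \<le> r" and r: "0 \<le> r"
  shows "l2_bound A r"
  unfolding l2_bound_def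
proof
  fix x :: "real vec" assume x: "x \<in> carrier_vec (dim_col A)"
  have "(A *\<^sub>v x) \<bullet> (A *\<^sub>v x) = (\<Sum>i<n. (\<Sum>j<n. A $$ (i, j) * x $ j)\<^sup>2)"
    using x A by (simp add: scalar_prod_def power2_eq_square lessThan_atLeast0)
  also have "\<dots> \<le> (\<Sum>i<n. r * (\<Sum>j<n. \<bar>A $$ (i, j)\<bar> * (x $ j)\<^sup>2))"
  proof (rule sum_mono)
    fix i assume i: "i \<in> {..<n}"
    have "(\<Sum>j<n. A $$ (i, j) * x $ j)\<^sup>2 \<le> (\<Sum>j<n. \<bar>A $$ (i, j)\<bar> * \<bar>x $ j\<bar>)\<^sup>2"
      by (rule power2_le_iff_abs_le[THEN iffD2])
        (auto intro!: sum_nonneg order.trans[OF sum_abs] simp: abs_mult)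
    \<comment> \<open>Splitting the weight evenly keeps |A_ij| to the first power in both factors of
      Cauchy--Schwarz.\<close>
    also have "\<dots> = (\<Sum>j<n. sqrt \<bar>A $$ (i, j)\<bar> * (sqrt \<bar>A $$ (i, j)\<bar> * \<bar>x $ j\<bar>))\<^sup>2"
      by (simp add: mult.assoc[symmetric])
    also have "\<dots> \<le> (\<Sum>j<n. (sqrt \<bar>A $$ (i, j)\<bar>)\<^sup>2) * (\<Sum>j<n. (sqrt \<bar>A $$ (i, j)\<bar> * \<bar>x $ j\<bar>)\<^sup>2)"
      by (rule Cauchy_Schwarz_real_sum)
    also have "\<dots> = (\<Sum>j<n. \<bar>A $$ (i, j)\<bar>) * (\<Sum>j<n. \<bar>A $$ (i, j)\<bar> * (x $ j)\<^sup>2)"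
      by (simp add: power_mult_distrib)
    also have "\<dots> \<le> r * (\<Sum>j<n. \<bar>A $$ (i, j)\<bar> * (x $ j)\<^sup>2)"
      using i by (intro mult_right_mono row sum_nonneg) auto
    finally show "(\<Sum>j<n. A $$ (i, j) * x $ j)\<^sup>2 \<le> \<dots>" .
  qed
  also have "\<dots> = r * (\<Sum>j<n. (\<Sum>i<n. \<bar>A $$ (i, j)\<bar>) * (x $ j)\<^sup>2)"
    by (subst sum_distrib_left[symmetric], subst sum.swap) (simp add: sum_distrib_right)
  also have "\<dots> = r * (\<Sum>j<n. (\<Sum>i<n. \<bar>A $$ (j, i)\<bar>) * (x $ j)\<^sup>2)"
    using sym by simp
  also have "\<dots> \<le> r * (\<Sum>j<n. r * (x $ j)\<^sup>2)"
    by (intro mult_left_mono sum_mono mult_right_mono row r) auto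
  also have "\<dots> = r\<^sup>2 * (x \<bullet> x)"
    using x A by (simp add: scalar_prod_def power2_eq_square lessThan_atLeast0 sum_distrib_left
        mult.assoc)
  finally show "(A *\<^sub>v x) \<bullet> (A *\<^sub>v x) \<le> r\<^sup>2 * (x \<bullet> x)" .
qed

section \<open>Adjoints, Gram matrices and entrywise norm estimates\<close>

lemma scalar_prod_transpose:
  fixes A :: "real mat"
  assumes "A \<in> carrier_mat p q" "x \<in> carrier_vec p" "y \<in> carrier_vec q"
  shows "x \<bullet> (A *\<^sub>v y) = (A\<^sup>T *\<^sub>v x) \<bullet> y"
proof -
  have "x \<bullet> (A *\<^sub>v y) = (\<Sum>i<p. \<Sum>j<q. x $ i * (A $$ (i, j) * y $ j))"
    using assms by (simp add: scalar_prod_def sum_distrib_left lessThan_atLeast0)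
  also have "\<dots> = (\<Sum>j<q. \<Sum>i<p. A $$ (i, j) * x $ i * y $ j)"
    by (subst sum.swap) (simp add: algebra_simps)
  also have "\<dots> = (A\<^sup>T *\<^sub>v x) \<bullet> y"
    using assms by (simp add: scalar_prod_def sum_distrib_right lessThan_atLeast0)
  finally show ?thesis .
qed

text \<open>Transfers Cauchy--Schwarz and positivity from the Euclidean product to the form of a
  Gram matrix.\<close>

lemma scalar_prod_gram:
  fixes M :: "real mat"
  assumes M: "M \<in> carrier_mat n k" and x: "x \<in> carrier_vec n" and y: "y \<in> carrier_vec n"
  shows "x \<bullet> ((M * M\<^sup>T) *\<^sub>v y) = (M\<^sup>T *\<^sub>v x) \<bullet> (M\<^sup>T *\<^sub>v y)"
proof -
  have "(M * M\<^sup>T) *\<^sub>v y = M *\<^sub>v (M\<^sup>T *\<^sub>v y)"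
    using M y by (intro assoc_mult_mat_vec[of _ n k _ n]) auto
  moreover have "M\<^sup>T *\<^sub>v y \<in> carrier_vec k" using M y by auto
  ultimately show ?thesis using scalar_prod_transpose[OF M x] by simp
qed

text \<open>Cauchy--Schwarz for the semidefinite form $\langle x, M M^T y\rangle$ at $y = M M^T x$
  turns a bound on the quadratic form into a bound on the norm.\<close>

lemma l2_bound_gram:
  assumes M: "M \<in> carrier_mat n k" and b: "0 \<le> b"
    and q: "\<And>x. x \<in> carrier_vec n \<Longrightarrow> x \<bullet> ((M * M\<^sup>T) *\<^sub>v x) \<le> b * (x \<bullet> x)"
  shows "l2_bound (M * M\<^sup>T) b"
  unfolding l2_bound_def
proof
  fix x :: "real vec" assume "x \<in> carrier_vec (dim_col (M * M\<^sup>T))"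
  then have x: "x \<in> carrier_vec n" using M by simp
  let ?A = "M * M\<^sup>T"
  define y where "y = ?A *\<^sub>v x"
  have y: "y \<in> carrier_vec n" using M x by (auto simp: y_def)
  have "(y \<bullet> y)\<^sup>2 = (y \<bullet> (?A *\<^sub>v x))\<^sup>2" by (simp add: y_def)
  also have "\<dots> \<le> (y \<bullet> (?A *\<^sub>v y)) * (x \<bullet> (?A *\<^sub>v x))"
    unfolding scalar_prod_gram[OF M y x] scalar_prod_gram[OF M y y] scalar_prod_gram[OF M x x]
    using M x y by (intro scalar_prod_Cauchy_Schwarz[of _ k]) auto
  also have "\<dots> \<le> (b * (y \<bullet> y)) * (b * (x \<bullet> x))"
    using b x y by (intro mult_mono q mult_nonneg_nonneg scalar_prod_self_nonneg)
      (auto simp: scalar_prod_gram[OF M x x] scalar_prod_self_nonneg)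
  finally have *: "(y \<bullet> y) * (y \<bullet> y) \<le> (b\<^sup>2 * (x \<bullet> x)) * (y \<bullet> y)"
    by (simp add: power2_eq_square algebra_simps)
  show "(?A *\<^sub>v x) \<bullet> (?A *\<^sub>v x) \<le> b\<^sup>2 * (x \<bullet> x)"
  proof (cases "y \<bullet> y = 0")
    case True
    then show ?thesis using scalar_prod_self_nonneg[of x] by (simp add: y_def)
  next
    case False
    then have "0 < y \<bullet> y" using scalar_prod_self_nonneg[of y] by simp
    with * have "y \<bullet> y \<le> b\<^sup>2 * (x \<bullet> x)" by (rule mult_right_le_imp_le)
    then show ?thesis by (simp add: y_def)
  qed
qed

lemma l2_bound_mono:
  assumes "l2_bound A c" "0 \<le> c" "c \<le> d"
  shows "l2_bound A d"
  unfolding l2_bound_def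
proof
  fix x :: "real vec" assume "x \<in> carrier_vec (dim_col A)"
  then have "(A *\<^sub>v x) \<bullet> (A *\<^sub>v x) \<le> c\<^sup>2 * (x \<bullet> x)" using assms(1) by (simp add: l2_bound_def)
  also have "\<dots> \<le> d\<^sup>2 * (x \<bullet> x)"
    using assms by (intro mult_right_mono power_mono scalar_prod_self_nonneg)
  finally show "(A *\<^sub>v x) \<bullet> (A *\<^sub>v x) \<le> d\<^sup>2 * (x \<bullet> x)" .
qed

text \<open>At a unit vector the norm dominates a whole column, hence each of its entries. This is
  the source of the lower bounds on spectral norms.\<close>

lemma abs_entry_le_op_norm2:
  assumes A: "A \<in> carrier_mat p q" and i: "i < p" and j: "j < q"
  shows "\<bar>A $$ (i, j)\<bar> \<le> op_norm vec_norm2 A"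
proof (rule power2_le_imp_le)
  let ?e = "unit_vec q j :: real vec"
  have "\<bar>A $$ (i, j)\<bar>\<^sup>2 = ((A *\<^sub>v ?e) $ i)\<^sup>2" using A i j by simp
  also have "\<dots> \<le> (\<Sum>k<p. ((A *\<^sub>v ?e) $ k)\<^sup>2)" using i by (intro member_le_sum) auto
  also have "\<dots> = (A *\<^sub>v ?e) \<bullet> (A *\<^sub>v ?e)"
    using A by (simp add: scalar_prod_def[of _ "A *\<^sub>v ?e"] power2_eq_square lessThan_atLeast0
        del: index_mult_mat_vec)
  also have "\<dots> \<le> (op_norm vec_norm2 A)\<^sup>2 * (?e \<bullet> ?e)"
    using A by (intro l2_boundD l2_bound_op_norm2) auto
  finally show "\<bar>A $$ (i, j)\<bar>\<^sup>2 \<le> (op_norm vec_norm2 A)\<^sup>2" using j by simp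
qed (use A j in \<open>simp add: op_norm2_nonneg\<close>)

lemma op_norm_inf_le:
  assumes "A \<in> carrier_mat n n" "0 < n" "\<And>i. i < n \<Longrightarrow> (\<Sum>j<n. \<bar>A $$ (i, j)\<bar>) \<le> r"
  shows "op_norm vec_norm_inf A \<le> r"
proof -
  have "Max ((\<lambda>i. \<Sum>j<n. \<bar>A $$ (i, j)\<bar>) ` {..<n}) \<le> r"
    using assms by (intro Max.boundedI) auto
  then show ?thesis using assms(1,2) by (subst op_norm_inf_eq_max_row_sum) auto
qed

lemma abs_entry_le_op_norm_inf:
  assumes "A \<in> carrier_mat n n" "i < n" "j < n"
  shows "\<bar>A $$ (i, j)\<bar> \<le> op_norm vec_norm_inf A"
proof -
  have "\<bar>A $$ (i, j)\<bar> \<le> (\<Sum>k<n. \<bar>A $$ (i, k)\<bar>)" using assms(3) by (intro member_le_sum) auto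
  also have "\<dots> \<le> op_norm vec_norm_inf A"
    using assms by (subst op_norm_inf_eq_max_row_sum) (auto intro!: Max_ge)
  finally show ?thesis .
qed

lemma op_norm1_eq_op_norm_inf_symmetric:
  assumes A: "A \<in> carrier_mat n n" "0 < n" and sym: "A\<^sup>T = A"
  shows "op_norm vec_norm1 A = op_norm vec_norm_inf A"
proof -
  have "A $$ (i, j) = A $$ (j, i)" if "i < n" "j < n" for i j
    using A that by (metis carrier_matD index_transpose_mat(1) sym)
  then have "(\<lambda>j. \<Sum>i<n. \<bar>A $$ (i, j)\<bar>) ` {..<n} = (\<lambda>j. \<Sum>i<n. \<bar>A $$ (j, i)\<bar>) ` {..<n}"
    by (intro image_cong sum.cong) auto
  then show ?thesis
    using A by (subst op_norm1_eq_max_col_sum, simp, subst op_norm_inf_eq_max_row_sum) auto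
qed

lemma transpose_eqI:
  assumes "A \<in> carrier_mat n n" "\<And>i j. i < n \<Longrightarrow> j < n \<Longrightarrow> A $$ (i, j) = A $$ (j, i)"
  shows "A\<^sup>T = A"
  using assms by (intro eq_matI) auto

section \<open>Kronecker products\<close>

text \<open>The index arithmetic behind all Kronecker identities below: once the summand depends on
  the pair (k div q, k mod q), the single sum becomes a double sum that can be factored.\<close>

lemma sum_lessThan_div_mod:
  fixes f :: "nat \<Rightarrow> nat \<Rightarrow> 'a :: comm_monoid_add"
  shows "(\<Sum>k<p * q. f (k div q) (k mod q)) = (\<Sum>a<p. \<Sum>i<q. f a i)"
proof -
  have "(\<Sum>k<p * q. f (k div q) (k mod q)) = (\<Sum>a<p. \<Sum>k=a * q..<a * q + q. f (k div q) (k mod q))"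
    by (rule sum.nat_group[symmetric])
  also have "\<dots> = (\<Sum>a<p. \<Sum>i<q. f a i)"
  proof (rule sum.cong)
    fix a
    have "(\<Sum>k=a * q..<a * q + q. f (k div q) (k mod q)) = (\<Sum>i<q. f ((i + a * q) div q) ((i + a * q) mod q))"
      using sum.shift_bounds_nat_ivl[of "\<lambda>k. f (k div q) (k mod q)" 0 "a * q" q]
      by (simp add: lessThan_atLeast0 add.commute)
    also have "\<dots> = (\<Sum>i<q. f a i)" by (intro sum.cong) auto
    finally show "(\<Sum>k=a * q..<a * q + q. f (k div q) (k mod q)) = (\<Sum>i<q. f a i)" .
  qed simp
  finally show ?thesis .
qed

lemma mod_less_of_less_mult: "k < p * q \<Longrightarrow> k mod q < (q :: nat)"
  by (cases "q = 0") auto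

lemma kronecker_carrier:
  "A \<in> carrier_mat p q \<Longrightarrow> B \<in> carrier_mat r s \<Longrightarrow> kronecker A B \<in> carrier_mat (p * r) (q * s)"
  by (simp add: kronecker_def)

lemma index_kronecker:
  assumes "A \<in> carrier_mat p q" "B \<in> carrier_mat r s" "i < p * r" "j < q * s"
  shows "kronecker A B $$ (i, j) = A $$ (i div r, j div s) * B $$ (i mod r, j mod s)"
  using assms by (simp add: kronecker_def)

text \<open>Mixed-product rule; it turns inverses and Gram factorizations of the factors into those
  of their Kronecker product.\<close>

lemma kronecker_mult:
  fixes A B C D :: "'a :: comm_semiring_1 mat"
  assumes A: "A \<in> carrier_mat p q" and B: "B \<in> carrier_mat r s"
    and C: "C \<in> carrier_mat q t" and D: "D \<in> carrier_mat s u"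
  shows "kronecker A B * kronecker C D = kronecker (A * C) (B * D)"
proof (rule eq_matI)
  have AC: "A * C \<in> carrier_mat p t" and BD: "B * D \<in> carrier_mat r u" using assms by auto
  fix i j assume "i < dim_row (kronecker (A * C) (B * D))" "j < dim_col (kronecker (A * C) (B * D))"
  then have i: "i < p * r" and j: "j < t * u" using assms by (auto simp: kronecker_def)
  have i': "i div r < p" "i mod r < r" using i by (auto simp: less_mult_imp_div_less mod_less_of_less_mult)
  have j': "j div u < t" "j mod u < u" using j by (auto simp: less_mult_imp_div_less mod_less_of_less_mult)
  have "(kronecker A B * kronecker C D) $$ (i, j)
      = (\<Sum>k<q * s. kronecker A B $$ (i, k) * kronecker C D $$ (k, j))"
    using kronecker_carrier[OF A B] kronecker_carrier[OF C D] i j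
    by (simp add: scalar_prod_def lessThan_atLeast0)
  also have "\<dots> = (\<Sum>k<q * s. A $$ (i div r, k div s) * B $$ (i mod r, k mod s)
      * (C $$ (k div s, j div u) * D $$ (k mod s, j mod u)))"
    using i j by (intro sum.cong) (auto simp: index_kronecker[OF A B] index_kronecker[OF C D])
  also have "\<dots> = (\<Sum>a<q. \<Sum>b<s. A $$ (i div r, a) * B $$ (i mod r, b)
      * (C $$ (a, j div u) * D $$ (b, j mod u)))"
    by (rule sum_lessThan_div_mod)
  also have "\<dots> = (\<Sum>a<q. A $$ (i div r, a) * C $$ (a, j div u))
      * (\<Sum>b<s. B $$ (i mod r, b) * D $$ (b, j mod u))"
    by (simp add: sum_product algebra_simps)
  also have "\<dots> = kronecker (A * C) (B * D) $$ (i, j)"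
    using assms i' j' by (simp add: index_kronecker[OF AC BD i j] scalar_prod_def lessThan_atLeast0)
  finally show "(kronecker A B * kronecker C D) $$ (i, j) = kronecker (A * C) (B * D) $$ (i, j)" .
qed (use assms in \<open>auto simp: kronecker_def\<close>)

lemma transpose_kronecker: "(kronecker A B)\<^sup>T = kronecker A\<^sup>T B\<^sup>T"
  by (rule eq_matI) (auto simp: kronecker_def less_mult_imp_div_less mod_less_of_less_mult)

lemma kronecker_one: "kronecker (1\<^sub>m p) (1\<^sub>m q) = (1\<^sub>m (p * q) :: 'a :: semiring_1 mat)"
proof (rule eq_matI)
  fix i j assume "i < dim_row (1\<^sub>m (p * q) :: 'a mat)" "j < dim_col (1\<^sub>m (p * q) :: 'a mat)"
  then have i: "i < p * q" and j: "j < p * q" by auto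
  have "i div q = j div q \<and> i mod q = j mod q \<longleftrightarrow> i = j"
    by (metis div_mult_mod_eq)
  then show "kronecker (1\<^sub>m p) (1\<^sub>m q) $$ (i, j) = (1\<^sub>m (p * q) :: 'a mat) $$ (i, j)"
    using i j by (auto simp: index_kronecker[OF one_carrier_mat one_carrier_mat]
        less_mult_imp_div_less mod_less_of_less_mult)
qed (auto simp: kronecker_def)

lemma kronecker_row_sum_abs:
  fixes A B :: "real mat"
  assumes A: "A \<in> carrier_mat p q" and B: "B \<in> carrier_mat r s" and i: "i < p * r"
  shows "(\<Sum>j<q * s. \<bar>kronecker A B $$ (i, j)\<bar>)
    = (\<Sum>a<q. \<bar>A $$ (i div r, a)\<bar>) * (\<Sum>b<s. \<bar>B $$ (i mod r, b)\<bar>)"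
proof -
  have "(\<Sum>j<q * s. \<bar>kronecker A B $$ (i, j)\<bar>)
      = (\<Sum>j<q * s. \<bar>A $$ (i div r, j div s)\<bar> * \<bar>B $$ (i mod r, j mod s)\<bar>)"
    using i by (intro sum.cong) (auto simp: index_kronecker[OF A B] abs_mult)
  also have "\<dots> = (\<Sum>a<q. \<Sum>b<s. \<bar>A $$ (i div r, a)\<bar> * \<bar>B $$ (i mod r, b)\<bar>)"
    by (rule sum_lessThan_div_mod)
  finally show ?thesis by (simp add: sum_product)
qed

lemma l2_bound_sum:
  assumes "l2_bound A c" "A \<in> carrier_mat p q"
  shows "(\<Sum>i<p. (\<Sum>j<q. A $$ (i, j) * f j)\<^sup>2) \<le> c\<^sup>2 * (\<Sum>j<q. (f j)\<^sup>2)"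
proof -
  have "(A *\<^sub>v vec q f) \<bullet> (A *\<^sub>v vec q f) \<le> c\<^sup>2 * (vec q f \<bullet> vec q f)"
    using assms by (intro l2_boundD) auto
  then show ?thesis
    using assms(2) by (simp add: scalar_prod_def power2_eq_square lessThan_atLeast0)
qed

text \<open>Read \<open>x\<close> as a q-by-s array \<open>X\<close>. The product applies
  \<open>B\<close> along the second index, giving \<open>Y\<close>, and then \<open>A\<close> along
  the first; each pass multiplies the sum of squares by at most the square of its bound.\<close>

lemma l2_bound_kronecker:
  assumes A: "A \<in> carrier_mat p q" and B: "B \<in> carrier_mat r s"
    and a: "l2_bound A a" and b: "l2_bound B b"
  shows "l2_bound (kronecker A B) (a * b)"
  unfolding l2_bound_def
proof
  fix x :: "real vec" assume "x \<in> carrier_vec (dim_col (kronecker A B))"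
  then have x: "x \<in> carrier_vec (q * s)" using A B by (simp add: kronecker_def)
  define X where "X c j = x $ (c * s + j)" for c j
  define Y where "Y c i = (\<Sum>j<s. B $$ (i, j) * X c j)" for c i
  have xk: "x $ k = X (k div s) (k mod s)" for k by (simp add: X_def)
  have comp: "(kronecker A B *\<^sub>v x) $ i = (\<Sum>c<q. A $$ (i div r, c) * Y c (i mod r))"
    if i: "i < p * r" for i
  proof -
    have "(kronecker A B *\<^sub>v x) $ i = (\<Sum>k<q * s. kronecker A B $$ (i, k) * x $ k)"
      using kronecker_carrier[OF A B] i x by (simp add: scalar_prod_def lessThan_atLeast0)
    also have "\<dots> = (\<Sum>k<q * s. A $$ (i div r, k div s) * B $$ (i mod r, k mod s) * X (k div s) (k mod s))"
      using i by (intro sum.cong) (auto simp: index_kronecker[OF A B] xk)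
    also have "\<dots> = (\<Sum>c<q. \<Sum>j<s. A $$ (i div r, c) * B $$ (i mod r, j) * X c j)"
      by (rule sum_lessThan_div_mod)
    finally show ?thesis by (simp add: Y_def sum_distrib_left mult.assoc)
  qed
  have "(kronecker A B *\<^sub>v x) \<bullet> (kronecker A B *\<^sub>v x)
      = (\<Sum>i<p * r. (\<Sum>c<q. A $$ (i div r, c) * Y c (i mod r))\<^sup>2)"
    using kronecker_carrier[OF A B] x
    by (subst scalar_prod_def)
      (auto simp: comp power2_eq_square lessThan_atLeast0 simp del: index_mult_mat_vec intro!: sum.cong)
  also have "\<dots> = (\<Sum>h<p. \<Sum>i<r. (\<Sum>c<q. A $$ (h, c) * Y c i)\<^sup>2)"
    by (rule sum_lessThan_div_mod)
  also have "\<dots> = (\<Sum>i<r. \<Sum>h<p. (\<Sum>c<q. A $$ (h, c) * Y c i)\<^sup>2)"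
    by (rule sum.swap)
  also have "\<dots> \<le> (\<Sum>i<r. a\<^sup>2 * (\<Sum>c<q. (Y c i)\<^sup>2))"
    by (intro sum_mono l2_bound_sum[OF a A])
  also have "\<dots> = a\<^sup>2 * (\<Sum>c<q. \<Sum>i<r. (\<Sum>j<s. B $$ (i, j) * X c j)\<^sup>2)"
    by (subst sum.swap) (simp add: sum_distrib_left Y_def)
  also have "\<dots> \<le> a\<^sup>2 * (\<Sum>c<q. b\<^sup>2 * (\<Sum>j<s. (X c j)\<^sup>2))"
    by (intro mult_left_mono sum_mono l2_bound_sum[OF b B]) auto
  also have "\<dots> = (a * b)\<^sup>2 * (\<Sum>c<q. \<Sum>j<s. (X c j)\<^sup>2)"
    by (simp add: sum_distrib_left power_mult_distrib mult.assoc)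
  also have "(\<Sum>c<q. \<Sum>j<s. (X c j)\<^sup>2) = (\<Sum>k<q * s. (X (k div s) (k mod s))\<^sup>2)"
    by (rule sum_lessThan_div_mod[symmetric])
  also have "\<dots> = x \<bullet> x"
    using x by (simp add: scalar_prod_def xk[symmetric] power2_eq_square lessThan_atLeast0)
  finally show "(kronecker A B *\<^sub>v x) \<bullet> (kronecker A B *\<^sub>v x) \<le> (a * b)\<^sup>2 * (x \<bullet> x)" .
qed

text \<open>Uses the index order of \<open>kronecker\<close>, with the second factor varying
  fastest, so that a Kronecker product of matrices acts on it factor by factor.\<close>

definition kron_vec :: "'a :: times vec \<Rightarrow> 'a vec \<Rightarrow> 'a vec" where
  "kron_vec u v = vec (dim_vec u * dim_vec v) (\<lambda>k. u $ (k div dim_vec v) * v $ (k mod dim_vec v))"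

lemma kronecker_mult_kron_vec:
  fixes A B :: "'a :: comm_semiring_1 mat"
  assumes A: "A \<in> carrier_mat p q" and B: "B \<in> carrier_mat r s"
    and u: "u \<in> carrier_vec q" and v: "v \<in> carrier_vec s"
  shows "kronecker A B *\<^sub>v kron_vec u v = kron_vec (A *\<^sub>v u) (B *\<^sub>v v)"
proof (rule eq_vecI)
  fix i assume "i < dim_vec (kron_vec (A *\<^sub>v u) (B *\<^sub>v v))"
  then have i: "i < p * r" using A B by (simp add: kron_vec_def)
  then have i': "i div r < p" "i mod r < r" by (auto simp: less_mult_imp_div_less mod_less_of_less_mult)
  have "(kronecker A B *\<^sub>v kron_vec u v) $ i
      = (\<Sum>k<q * s. A $$ (i div r, k div s) * B $$ (i mod r, k mod s) * (u $ (k div s) * v $ (k mod s)))"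
    using kronecker_carrier[OF A B] i u v
    by (auto simp: scalar_prod_def lessThan_atLeast0 kron_vec_def index_kronecker[OF A B] intro!: sum.cong)
  also have "\<dots> = (\<Sum>a<q. \<Sum>b<s. A $$ (i div r, a) * B $$ (i mod r, b) * (u $ a * v $ b))"
    by (rule sum_lessThan_div_mod)
  also have "\<dots> = (\<Sum>a<q. A $$ (i div r, a) * u $ a) * (\<Sum>b<s. B $$ (i mod r, b) * v $ b)"
    by (simp add: sum_product algebra_simps)
  also have "\<dots> = kron_vec (A *\<^sub>v u) (B *\<^sub>v v) $ i"
    using A B u v i i' by (simp add: kron_vec_def scalar_prod_def lessThan_atLeast0)
  finally show "(kronecker A B *\<^sub>v kron_vec u v) $ i = kron_vec (A *\<^sub>v u) (B *\<^sub>v v) $ i" .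
qed (use A B in \<open>simp add: kron_vec_def kronecker_def\<close>)

lemma scalar_prod_kron_vec:
  fixes u v u' v' :: "'a :: comm_semiring_1 vec"
  assumes "dim_vec u = dim_vec u'" "dim_vec v = dim_vec v'"
  shows "kron_vec u v \<bullet> kron_vec u' v' = (u \<bullet> u') * (v \<bullet> v')"
proof -
  let ?p = "dim_vec u'" and ?q = "dim_vec v'"
  have "kron_vec u v \<bullet> kron_vec u' v'
      = (\<Sum>k<?p * ?q. u $ (k div ?q) * v $ (k mod ?q) * (u' $ (k div ?q) * v' $ (k mod ?q)))"
    using assms by (simp add: kron_vec_def scalar_prod_def lessThan_atLeast0)
  also have "\<dots> = (\<Sum>a<?p. \<Sum>b<?q. u $ a * v $ b * (u' $ a * v' $ b))"
    by (rule sum_lessThan_div_mod)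
  finally show ?thesis
    by (simp add: scalar_prod_def lessThan_atLeast0 sum_product algebra_simps)
qed

section \<open>Numerical radius of a strictly lower triangular matrix\<close>

text \<open>The constant is the largest eigenvalue of half the adjacency matrix of the path on n
  vertices, with eigenvector sin(k pi / (n + 1)), k = 1, ..., n. Weighting the arithmetic-geometric
  mean inequality on each edge by this eigenvector makes every diagonal coefficient equal to the
  cosine.\<close>

lemma path_graph_quadratic_form_le:
  fixes a :: "nat \<Rightarrow> real"
  assumes "a n = 0"
  shows "(\<Sum>k<n. a k * a (Suc k)) \<le> cos (pi / (real n + 1)) * (\<Sum>k<n. (a k)\<^sup>2)"
proof (cases n)
  case 0
  then show ?thesis by simp
next
  case (Suc p)
  define t where "t = pi / (real n + 1)"
  \<comment> \<open>The eigenvector is indexed from 1 and \<open>a\<close> from 0, so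
    \<open>a k\<close> is paired with \<open>s (Suc k)\<close>.\<close>
  define s where "s k = sin (real k * t)" for k
  have pos: "0 < s k" if "0 < k" "k \<le> n" for k
    unfolding s_def
  proof (rule sin_gt_zero)
    show "0 < real k * t" using that by (simp add: t_def)
    have "real k * pi < (real n + 1) * pi" using that by (intro mult_strict_right_mono) auto
    then show "real k * t < pi" by (simp add: t_def divide_less_eq mult.commute)
  qed
  have rec: "s k + s (Suc (Suc k)) = 2 * cos t * s (Suc k)" for k
  proof -
    have "real k * t = real (Suc k) * t - t" "real (Suc (Suc k)) * t = real (Suc k) * t + t"
      by (simp_all add: algebra_simps)
    then show ?thesis unfolding s_def by (simp only: sin_add sin_diff) simp
  qed
  \<comment> \<open>The last term is the share of (a m)^2 already spent on the edge to its left. The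
    recursion for \<open>s\<close> says that it and the share for the next edge add up to cos
    t.\<close>
  have partial: "(\<Sum>k<m. a k * a (Suc k)) \<le> cos t * (\<Sum>k<m. (a k)\<^sup>2) + s m / (2 * s (Suc m)) * (a m)\<^sup>2"
    if "m < n" for m
    using that
  proof (induction m)
    case 0
    then show ?case by (simp add: s_def)
  next
    case (Suc m)
    let ?u = "s (Suc m)" and ?v = "s (Suc (Suc m))"
    have u: "0 < ?u" and v: "0 < ?v" using Suc.prems by (intro pos; simp)+
    have "0 \<le> (?v * a m - ?u * a (Suc m))\<^sup>2 / (2 * ?u * ?v)" using u v by simp
    also have "\<dots> = ?v / (2 * ?u) * (a m)\<^sup>2 + ?u / (2 * ?v) * (a (Suc m))\<^sup>2 - a m * a (Suc m)"
      using u v by (simp add: field_simps power2_eq_square)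
    finally have "a m * a (Suc m) \<le> ?v / (2 * ?u) * (a m)\<^sup>2 + ?u / (2 * ?v) * (a (Suc m))\<^sup>2"
      by simp
    moreover have "s m / (2 * ?u) * (a m)\<^sup>2 + ?v / (2 * ?u) * (a m)\<^sup>2 = cos t * (a m)\<^sup>2"
    proof -
      have "s m / (2 * ?u) + ?v / (2 * ?u) = cos t"
        using u rec[of m] by (simp add: add_divide_distrib[symmetric] field_simps)
      then show ?thesis by (metis distrib_right)
    qed
    ultimately show ?case using Suc by (simp add: algebra_simps)
  qed
  \<comment> \<open>The sine vanishes just past the path, so the last vertex, which has no right
    edge, also gets the full coefficient cos t.\<close>
  have "s (Suc n) = 0" unfolding s_def t_def by (simp add: add.commute)
  then have "s p = 2 * cos t * s n" using rec[of p] Suc by simp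
  then have "s p / (2 * s (Suc p)) = cos t" using pos[of n] Suc by simp
  then have "(\<Sum>k<p. a k * a (Suc k)) \<le> cos t * (\<Sum>k<p. (a k)\<^sup>2) + cos t * (a p)\<^sup>2"
    using partial[of p] Suc by simp
  then show ?thesis using assms Suc by (simp add: t_def algebra_simps)
qed

text \<open>Each application of \<open>A\<close> moves the first possibly nonzero coordinate down by
  at least one.\<close>

lemma strictly_lower_triangular_nilpotent:
  fixes A :: "'a :: semiring_1 mat"
  assumes A: "A \<in> carrier_mat n n" and low: "\<And>i j. i \<le> j \<Longrightarrow> j < n \<Longrightarrow> A $$ (i, j) = 0"
    and x: "x \<in> carrier_vec n"
  shows "((\<lambda>v. A *\<^sub>v v) ^^ n) x = 0\<^sub>v n"
proof -
  let ?y = "\<lambda>k. ((\<lambda>v. A *\<^sub>v v) ^^ k) x"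
  have "?y k \<in> carrier_vec n \<and> (\<forall>i<n. i < k \<longrightarrow> ?y k $ i = 0)" for k
  proof (induction k)
    case 0
    then show ?case using x by simp
  next
    case (Suc k)
    have "?y (Suc k) $ i = 0" if i: "i < n" "i < Suc k" for i
    proof -
      have "A $$ (i, j) * ?y k $ j = 0" if "j < n" for j
        using Suc low[of i j] i that by (cases "i \<le> j") auto
      then have "(\<Sum>j<n. A $$ (i, j) * ?y k $ j) = 0" by (intro sum.neutral) auto
      moreover have "dim_vec (?y k) = n" using Suc by (simp add: carrier_vecD)
      ultimately show ?thesis using A i by (simp add: scalar_prod_def lessThan_atLeast0)
    qed
    then show ?case using A Suc by (auto intro: mult_mat_vec_carrier)
  qed
  then show ?thesis by (intro eq_vecI) (auto dest: carrier_vecD)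
qed

text \<open>The Haagerup--de la Harpe inequality. With the defect form
  $D(u,v) = \langle u,v\rangle - \langle Au,Av\rangle \ge 0$ of a contraction $A$, nilpotency makes
  $\langle x,x\rangle$ and $\langle x,Ax\rangle$ telescope into the sums over $k < n$ of
  $D(A^kx,A^kx)$ and $D(A^kx,A^{k+1}x)$, so Cauchy--Schwarz for $D$ reduces the claim to the
  quadratic form of a path.\<close>

lemma contraction_numerical_radius:
  fixes A :: "real mat"
  assumes A: "A \<in> carrier_mat n n" and low: "\<And>i j. i \<le> j \<Longrightarrow> j < n \<Longrightarrow> A $$ (i, j) = 0"
    and c: "l2_bound A 1" and x: "x \<in> carrier_vec n"
  shows "x \<bullet> (A *\<^sub>v x) \<le> cos (pi / (real n + 1)) * (x \<bullet> x)"
proof -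
  define y where "y k = ((\<lambda>v. A *\<^sub>v v) ^^ k) x" for k
  have y: "y k \<in> carrier_vec n" for k
    unfolding y_def using A x by (induction k) auto
  have ySuc: "y (Suc k) = A *\<^sub>v y k" for k by (simp add: y_def)
  have yn: "y n = 0\<^sub>v n" unfolding y_def by (rule strictly_lower_triangular_nilpotent[OF A low x])
  \<comment> \<open>\<open>d k\<close> and \<open>e k\<close> are the defect form at (y_k, y_k) and
    (y_k, y_(k+1)), where y_k = A^k x.\<close>
  define d where "d k = y k \<bullet> y k - y (Suc k) \<bullet> y (Suc k)" for k
  define e where "e k = y k \<bullet> y (Suc k) - y (Suc k) \<bullet> y (Suc (Suc k))" for k
  have d: "0 \<le> d k" for k
    using l2_boundD[OF c A y[of k]] by (simp add: d_def ySuc)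
  have e: "(e k)\<^sup>2 \<le> d k * d (Suc k)" for k
  proof (rule nonneg_quadratic_discriminant)
    fix s :: real
    let ?u = "y k + s \<cdot>\<^sub>v y (Suc k)"
    have Au: "A *\<^sub>v ?u = y (Suc k) + s \<cdot>\<^sub>v y (Suc (Suc k))"
      using A y by (simp add: mult_add_distrib_mat_vec[of _ n n] mult_mat_vec ySuc[of k, symmetric] ySuc[of "Suc k", symmetric])
    have sq: "(u + s \<cdot>\<^sub>v v) \<bullet> (u + s \<cdot>\<^sub>v v) = u \<bullet> u + 2 * s * (u \<bullet> v) + s\<^sup>2 * (v \<bullet> v)"
      if "u \<in> carrier_vec n" "v \<in> carrier_vec n" for u v :: "real vec"
      using that
      by (simp add: scalar_prod_def power2_eq_square algebra_simps sum.distrib sum_distrib_left)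
    have "0 \<le> ?u \<bullet> ?u - (A *\<^sub>v ?u) \<bullet> (A *\<^sub>v ?u)"
      using l2_boundD[OF c A, of ?u] y by simp
    also have "\<dots> = d k + 2 * e k * s + d (Suc k) * s\<^sup>2"
      unfolding Au by (simp add: sq y d_def e_def algebra_simps)
    finally show "0 \<le> \<dots>" .
  qed (rule d)
  have e': "e k \<le> sqrt (d k) * sqrt (d (Suc k))" for k
    using real_sqrt_le_mono[OF e[of k]] by (simp add: real_sqrt_mult)
  have zero: "y (Suc n) = 0\<^sub>v n"
    using A by (auto simp: ySuc yn intro!: eq_vecI)
  have "x \<bullet> (A *\<^sub>v x) = y 0 \<bullet> y (Suc 0) - y n \<bullet> y (Suc n)"
    by (simp add: yn zero) (simp add: y_def)
  also have "\<dots> = (\<Sum>k<n. e k)"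
    using sum_lessThan_telescope'[of "\<lambda>k. y k \<bullet> y (Suc k)" n] by (simp add: e_def)
  also have "\<dots> \<le> (\<Sum>k<n. sqrt (d k) * sqrt (d (Suc k)))"
    by (intro sum_mono e')
  \<comment> \<open>The path inequality with a_k = sqrt (d k); its boundary condition is
    \<open>d n = 0\<close>, which holds because \<open>y n\<close> and \<open>y (Suc n)\<close>
    vanish.\<close>
  also have "\<dots> \<le> cos (pi / (real n + 1)) * (\<Sum>k<n. (sqrt (d k))\<^sup>2)"
    by (rule path_graph_quadratic_form_le) (simp add: d_def yn zero)
  also have "(\<Sum>k<n. (sqrt (d k))\<^sup>2) = y 0 \<bullet> y 0 - y n \<bullet> y n"
    using sum_lessThan_telescope'[of "\<lambda>k. y k \<bullet> y k" n] d by (simp add: d_def)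
  also have "\<dots> = x \<bullet> x" by (simp add: yn) (simp add: y_def)
  finally show ?thesis .
qed

text \<open>Dividing by \<open>t\<close> gives a contraction; for \<open>t = 0\<close> no division
  is possible, but then \<open>A\<close> annihilates \<open>x\<close>.\<close>

lemma strictly_lower_triangular_numerical_radius:
  fixes A :: "real mat"
  assumes A: "A \<in> carrier_mat n n" and low: "\<And>i j. i \<le> j \<Longrightarrow> j < n \<Longrightarrow> A $$ (i, j) = 0"
    and c: "l2_bound A t" and t: "0 \<le> t" and x: "x \<in> carrier_vec n"
  shows "x \<bullet> (A *\<^sub>v x) \<le> t * cos (pi / (real n + 1)) * (x \<bullet> x)"
proof (cases "t = 0")
  case True
  then have "(A *\<^sub>v x) \<bullet> (A *\<^sub>v x) = 0"
    using l2_boundD[OF c A x] scalar_prod_self_nonneg[of "A *\<^sub>v x"] by simp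
  moreover have "A *\<^sub>v x \<in> carrier_vec n" using A x by simp
  ultimately have "A *\<^sub>v x = 0\<^sub>v n" by (simp only: scalar_prod_self_eq_0_iff)
  then show ?thesis using True x by simp
next
  case False
  let ?B = "(1 / t) \<cdot>\<^sub>m A"
  have Bv: "?B *\<^sub>v v = (1 / t) \<cdot>\<^sub>v (A *\<^sub>v v)" if "v \<in> carrier_vec n" for v
    using A that by (intro eq_vecI) (auto simp: scalar_prod_def sum_distrib_left mult.assoc)
  have "l2_bound ?B 1"
    unfolding l2_bound_def
  proof
    fix v :: "real vec" assume "v \<in> carrier_vec (dim_col ?B)"
    then have v: "v \<in> carrier_vec n" using A by simp
    have "(?B *\<^sub>v v) \<bullet> (?B *\<^sub>v v) = (1 / t)\<^sup>2 * ((A *\<^sub>v v) \<bullet> (A *\<^sub>v v))"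
      using A v by (simp add: Bv power2_eq_square)
    also have "\<dots> \<le> (1 / t)\<^sup>2 * (t\<^sup>2 * (v \<bullet> v))"
      by (intro mult_left_mono l2_boundD[OF c A v]) simp
    also have "\<dots> = 1\<^sup>2 * (v \<bullet> v)" using False by (simp add: power_divide)
    finally show "(?B *\<^sub>v v) \<bullet> (?B *\<^sub>v v) \<le> 1\<^sup>2 * (v \<bullet> v)" .
  qed
  then have "x \<bullet> (?B *\<^sub>v x) \<le> cos (pi / (real n + 1)) * (x \<bullet> x)"
    using A low x by (intro contraction_numerical_radius) auto
  moreover have "x \<bullet> (?B *\<^sub>v x) = x \<bullet> (A *\<^sub>v x) / t" using A x by (simp add: Bv)
  ultimately show ?thesis using t False by (simp add: divide_le_eq mult_ac)
qed

section \<open>Spectral radius and complex numerical range of a symmetric matrix\<close>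

text \<open>Powers are defined by multiplication on the right, while iterating on a vector needs the
  new factor on the left.\<close>

lemma pow_mat_Suc_left:
  fixes A :: "'a :: semiring_1 mat"
  assumes A: "A \<in> carrier_mat n n"
  shows "A ^\<^sub>m Suc k = A * A ^\<^sub>m k"
proof (induction k)
  case 0
  then show ?case using A by simp
next
  case (Suc k)
  have "A ^\<^sub>m Suc (Suc k) = (A * A ^\<^sub>m k) * A" using Suc by simp
  also have "\<dots> = A * (A ^\<^sub>m k * A)" using A by (intro assoc_mult_mat[of _ n n _ n _ n]) auto
  finally show ?case by simp
qed

text \<open>The sequence $\|A^k x\|^2$ is log-convex because $A$ is symmetric.\<close>

lemma symmetric_power_growth:
  fixes A :: "real mat"
  assumes A: "A \<in> carrier_mat n n" and sym: "A\<^sup>T = A"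
    and x: "x \<in> carrier_vec n" "x \<noteq> 0\<^sub>v n"
    and g: "0 < g" and ray: "g * (x \<bullet> x) \<le> x \<bullet> (A *\<^sub>v x)"
  shows "g ^ (2 * k) * (x \<bullet> x) \<le> (A ^\<^sub>m k *\<^sub>v x) \<bullet> (A ^\<^sub>m k *\<^sub>v x)"
proof -
  define y where "y k = A ^\<^sub>m k *\<^sub>v x" for k
  define b where "b k = y k \<bullet> y k" for k
  have y: "y k \<in> carrier_vec n" for k
    using A x by (auto simp: y_def intro!: mult_mat_vec_carrier[of _ n n])
  have y0: "y 0 = x" using A x by (simp add: y_def)
  have ySuc: "y (Suc k) = A *\<^sub>v y k" for k
    unfolding y_def pow_mat_Suc_left[OF A] using A x
    by (intro assoc_mult_mat_vec[of _ n n _ n]) auto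
  have convex: "b (Suc k) * b (Suc k) \<le> b k * b (Suc (Suc k))" for k
  proof -
    have "b (Suc k) = y k \<bullet> y (Suc (Suc k))"
      using scalar_prod_transpose[OF A y[of k] y[of "Suc k"]] sym by (simp add: b_def ySuc)
    then show ?thesis
      using scalar_prod_Cauchy_Schwarz[OF y[of k] y[of "Suc (Suc k)"]]
      by (simp add: b_def power2_eq_square)
  qed
  have pos: "0 < x \<bullet> x"
    using scalar_prod_self_nonneg[of x] scalar_prod_self_eq_0_iff[OF x(1)] x(2) by auto
  \<comment> \<open>Log-convexity makes the ratios of consecutive \<open>b k\<close> nondecreasing,
    so the first ratio, controlled by the Rayleigh quotient, bounds all others from below.
    Positivity travels along because each stage cancels \<open>b k\<close>.\<close>
  have step: "0 < b k \<and> g\<^sup>2 * b k \<le> b (Suc k)" for k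
  proof (induction k)
    case 0
    have "(g * (x \<bullet> x))\<^sup>2 \<le> (x \<bullet> y (Suc 0))\<^sup>2"
      using ray g pos by (intro power_mono) (auto simp: ySuc y0)
    also have "\<dots> \<le> (x \<bullet> x) * b (Suc 0)"
      unfolding b_def by (rule scalar_prod_Cauchy_Schwarz[OF x(1) y])
    finally have "(x \<bullet> x) * (g\<^sup>2 * (x \<bullet> x)) \<le> (x \<bullet> x) * b (Suc 0)"
      by (simp add: power2_eq_square mult_ac)
    then show ?case using pos by (simp add: b_def y0)
  next
    case (Suc k)
    then have b: "0 < b k" "g\<^sup>2 * b k \<le> b (Suc k)" by auto
    have "0 < g\<^sup>2 * b k" using g b(1) by simp
    with b(2) have b1: "0 < b (Suc k)" by linarith
    have "b k * (g\<^sup>2 * b (Suc k)) = (g\<^sup>2 * b k) * b (Suc k)" by simp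
    also have "\<dots> \<le> b (Suc k) * b (Suc k)" using b b1 by (intro mult_right_mono) auto
    also have "\<dots> \<le> b k * b (Suc (Suc k))" by (rule convex)
    finally have "g\<^sup>2 * b (Suc k) \<le> b (Suc (Suc k))" using b(1) by simp
    then show ?case using b1 by simp
  qed
  have "g ^ (2 * k) * (x \<bullet> x) \<le> b k"
  proof (induction k)
    case 0
    then show ?case by (simp add: b_def y0)
  next
    case (Suc k)
    have "g ^ (2 * Suc k) * (x \<bullet> x) = g\<^sup>2 * (g ^ (2 * k) * (x \<bullet> x))"
      by (simp add: power2_eq_square)
    also have "\<dots> \<le> g\<^sup>2 * b k" by (intro mult_left_mono Suc) simp
    also have "\<dots> \<le> b (Suc k)" using step by blast
    finally show ?case .
  qed
  then show ?thesis by (simp add: b_def y_def)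
qed

text \<open>An eigenvector of the scaled matrix is one of \<open>A\<close>, with its eigenvalue
  multiplied by \<open>s\<close>; this direction alone gives the upper bound.\<close>

lemma spectral_radius_smult_less_1:
  fixes A :: "complex mat"
  assumes A: "A \<in> carrier_mat n n" and n: "0 < n" and s: "0 < s" "spectral_radius A < s"
  shows "spectral_radius (complex_of_real (1 / s) \<cdot>\<^sub>m A) < 1"
proof -
  let ?B = "complex_of_real (1 / s) \<cdot>\<^sub>m A"
  have B: "?B \<in> carrier_mat n n" using A by simp
  obtain ev where ev: "eigenvalue ?B ev" "spectral_radius ?B = norm ev"
    using spectral_radius_mem_max(1)[OF B n] by (auto simp: spectrum_def)
  then obtain v where v: "v \<in> carrier_vec n" "v \<noteq> 0\<^sub>v n" "?B *\<^sub>v v = ev \<cdot>\<^sub>v v"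
    using A by (auto simp: eigenvalue_def eigenvector_def)
  have Bv: "?B *\<^sub>v v = complex_of_real (1 / s) \<cdot>\<^sub>v (A *\<^sub>v v)"
    using A v(1) by (intro eq_vecI) (auto simp: scalar_prod_def sum_distrib_left mult.assoc)
  have "complex_of_real s \<cdot>\<^sub>v (ev \<cdot>\<^sub>v v)
      = complex_of_real s \<cdot>\<^sub>v (complex_of_real (1 / s) \<cdot>\<^sub>v (A *\<^sub>v v))"
    by (simp only: v(3)[symmetric] Bv)
  also have "\<dots> = A *\<^sub>v v" using s(1) by (intro eq_vecI) auto
  finally have "A *\<^sub>v v = (complex_of_real s * ev) \<cdot>\<^sub>v v" by (simp add: smult_smult_assoc)
  then have "eigenvalue A (complex_of_real s * ev)"
    using A v by (auto simp: eigenvalue_def eigenvector_def)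
  then have "norm (complex_of_real s * ev) \<le> spectral_radius A"
    using spectral_radius_mem_max(2)[OF A n] by (auto simp: spectrum_def)
  then have "s * norm ev < s * 1" using s by (simp only: norm_mult norm_of_real)
  then have "norm ev < 1" using s(1) by (simp only: mult_less_cancel_left_pos)
  then show ?thesis using ev(2) by simp
qed

lemma spectral_radius_ge_Rayleigh_quotient:
  fixes A :: "real mat"
  assumes A: "A \<in> carrier_mat n n" and sym: "A\<^sup>T = A"
    and x: "x \<in> carrier_vec n" "x \<noteq> 0\<^sub>v n"
    and r: "0 < r" and ray: "r * (x \<bullet> x) \<le> x \<bullet> (A *\<^sub>v x)"
  shows "r \<le> spectral_radius (map_mat complex_of_real A)"
proof (rule ccontr)
  let ?A = "map_mat complex_of_real A"
  assume "\<not> r \<le> spectral_radius ?A"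
  \<comment> \<open>Division by an \<open>s\<close> strictly between the two numbers pushes the
    spectral radius below 1 and the Rayleigh quotient above 1. The maximum with 0 keeps
    \<open>s\<close> positive.\<close>
  then obtain s where s: "spectral_radius ?A < s" "s < r" "0 < s"
    using r dense[of "max 0 (spectral_radius ?A)" r] by auto
  have n: "0 < n" using x by (cases n) auto
  define R where "R = (1 / s) \<cdot>\<^sub>m A"
  have R: "R \<in> carrier_mat n n" using A by (simp add: R_def)
  have "R\<^sup>T = (1 / s) \<cdot>\<^sub>m A\<^sup>T" unfolding R_def by (intro eq_matI) auto
  then have Rsym: "R\<^sup>T = R" by (simp add: sym R_def)
  have cR: "map_mat complex_of_real R = complex_of_real (1 / s) \<cdot>\<^sub>m ?A"
    using A by (intro eq_matI) (auto simp: R_def)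
  have "spectral_radius (map_mat complex_of_real R) < 1"
    unfolding cR using A n s by (intro spectral_radius_smult_less_1[of _ n]) auto
  then obtain c where c: "\<And>k. norm_bound (map_mat complex_of_real R ^\<^sub>m k) c"
    using spectral_radius_jnf_norm_bound_less_1_upper_triangular[of "map_mat complex_of_real R" n] R
    by auto
  have pow: "map_mat complex_of_real (R ^\<^sub>m k) = map_mat complex_of_real R ^\<^sub>m k" for k
    by (rule of_real_hom.mat_hom_pow[OF R])
  have Rk: "R ^\<^sub>m k \<in> carrier_mat n n" for k using R by simp
  have entry: "\<bar>(R ^\<^sub>m k) $$ (i, j)\<bar> \<le> c" if "i < n" "j < n" for i j k
  proof -
    have "norm (map_mat complex_of_real (R ^\<^sub>m k) $$ (i, j)) \<le> c"
      using c[of k] that carrier_matD[OF Rk[of k]] unfolding pow[symmetric] norm_bound_def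
      by (simp del: pow_mat_dim)
    then show ?thesis using that by (simp add: carrier_matD[OF Rk] del: pow_mat_dim)
  qed
  \<comment> \<open>Bounds every component of R^k x, uniformly in k.\<close>
  define K where "K = (\<Sum>j<n. c * \<bar>x $ j\<bar>)"
  have bound: "(R ^\<^sub>m k *\<^sub>v x) \<bullet> (R ^\<^sub>m k *\<^sub>v x) \<le> real n * K\<^sup>2" for k
  proof -
    have "\<bar>(R ^\<^sub>m k *\<^sub>v x) $ i\<bar> \<le> K" if i: "i < n" for i
    proof -
      have "\<bar>(R ^\<^sub>m k *\<^sub>v x) $ i\<bar> = \<bar>\<Sum>j<n. (R ^\<^sub>m k) $$ (i, j) * x $ j\<bar>"
        using x(1) i
        by (simp add: scalar_prod_def lessThan_atLeast0 carrier_matD[OF Rk] del: pow_mat_dim)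
      also have "\<dots> \<le> K" unfolding K_def
        by (intro order.trans[OF sum_abs] sum_mono)
          (use entry i in \<open>auto simp: abs_mult intro!: mult_right_mono\<close>)
      finally show ?thesis .
    qed
    then have "((R ^\<^sub>m k *\<^sub>v x) $ i)\<^sup>2 \<le> K\<^sup>2" if "i < n" for i
      using that by (meson abs_le_square_iff abs_ge_self order_trans)
    then have "(\<Sum>i<n. ((R ^\<^sub>m k *\<^sub>v x) $ i)\<^sup>2) \<le> (\<Sum>i<n. K\<^sup>2)" by (intro sum_mono) auto
    then show ?thesis
      by (simp add: scalar_prod_def[of "R ^\<^sub>m k *\<^sub>v x"] power2_eq_square lessThan_atLeast0
          carrier_matD[OF Rk] del: pow_mat_dim index_mult_mat_vec)
  qed
  have pos: "0 < x \<bullet> x"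
    using scalar_prod_self_nonneg[of x] scalar_prod_self_eq_0_iff[OF x(1)] x(2) by auto
  have "R *\<^sub>v x = (1 / s) \<cdot>\<^sub>v (A *\<^sub>v x)"
    unfolding R_def using A x(1) by (intro eq_vecI) (auto simp: scalar_prod_def sum_distrib_left mult.assoc)
  then have "r / s * (x \<bullet> x) \<le> x \<bullet> (R *\<^sub>v x)"
    using ray A x(1) s(3) by (simp add: divide_right_mono)
  then have growth: "(r / s) ^ (2 * k) * (x \<bullet> x) \<le> real n * K\<^sup>2" for k
    using symmetric_power_growth[OF R Rsym x, of "r / s" k] bound[of k] s r
    by (meson divide_pos_pos order_trans)
  have "1 < (r / s)\<^sup>2" using s by (intro one_less_power) auto
  then obtain k where "real n * K\<^sup>2 / (x \<bullet> x) < ((r / s)\<^sup>2) ^ k"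
    using real_arch_pow by blast
  then have "real n * K\<^sup>2 < (r / s) ^ (2 * k) * (x \<bullet> x)"
    using pos by (simp add: divide_less_eq power_mult)
  then show False using growth[of k] by simp
qed

text \<open>For v = a + ib the imaginary part is a.(Ab) - b.(Aa), which symmetry cancels. Complex
  eigenvalues and numerical ranges thus reduce to real forms.\<close>

lemma complex_quadratic_form:
  fixes A :: "real mat" and v :: "complex vec"
  assumes A: "A \<in> carrier_mat n n" and sym: "A\<^sup>T = A" and v: "v \<in> carrier_vec n"
  shows "(map_mat complex_of_real A *\<^sub>v v) \<bullet>c v
    = complex_of_real (map_vec Re v \<bullet> (A *\<^sub>v map_vec Re v) + map_vec Im v \<bullet> (A *\<^sub>v map_vec Im v))"
proof -
  let ?a = "map_vec Re v" and ?b = "map_vec Im v"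
  have ab: "?a \<in> carrier_vec n" "?b \<in> carrier_vec n" using v by auto
  have entry: "(map_mat complex_of_real A *\<^sub>v v) $ i = Complex ((A *\<^sub>v ?a) $ i) ((A *\<^sub>v ?b) $ i)"
    if "i < n" for i
    using that A v by (auto simp: complex_eq_iff scalar_prod_def)
  have "(map_mat complex_of_real A *\<^sub>v v) \<bullet>c v
      = (\<Sum>i<n. Complex ((A *\<^sub>v ?a) $ i) ((A *\<^sub>v ?b) $ i) * cnj (v $ i))"
    using A v
    by (subst scalar_prod_def) (auto simp: entry lessThan_atLeast0 simp del: index_mult_mat_vec
        intro!: sum.cong)
  also have "\<dots> = Complex (?a \<bullet> (A *\<^sub>v ?a) + ?b \<bullet> (A *\<^sub>v ?b)) (?a \<bullet> (A *\<^sub>v ?b) - ?b \<bullet> (A *\<^sub>v ?a))"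
    using A v
    by (simp add: complex_eq_iff scalar_prod_def[of ?a] scalar_prod_def[of ?b] lessThan_atLeast0
        sum.distrib sum_subtractf mult.commute del: index_mult_mat_vec)
  also have "?a \<bullet> (A *\<^sub>v ?b) = ?b \<bullet> (A *\<^sub>v ?a)"
    using scalar_prod_transpose[OF A ab] comm_scalar_prod[of "A *\<^sub>v ?a" n ?b] A ab sym by simp
  finally show ?thesis by (simp add: complex_eq_iff)
qed

lemma complex_scalar_prod_self:
  fixes v :: "complex vec"
  shows "v \<bullet>c v = complex_of_real (map_vec Re v \<bullet> map_vec Re v + map_vec Im v \<bullet> map_vec Im v)"
  by (simp add: scalar_prod_def complex_eq_iff sum.distrib sum_subtractf mult.commute)

lemma vec_norm2_complex:
  fixes v :: "complex vec"
  shows "vec_norm2 v = sqrt (map_vec Re v \<bullet> map_vec Re v + map_vec Im v \<bullet> map_vec Im v)"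
  by (simp add: vec_norm2_def scalar_prod_def lessThan_atLeast0 cmod_power2 sum.distrib
      flip: power2_eq_square)

lemma map_vec_Re_Im_eq_0:
  assumes "v \<in> carrier_vec n" "map_vec Re v = 0\<^sub>v n" "map_vec Im v = 0\<^sub>v n"
  shows "v = 0\<^sub>v n"
proof (rule eq_vecI)
  fix i assume "i < dim_vec (0\<^sub>v n :: complex vec)"
  then have i: "i < n" by simp
  have "map_vec Re v $ i = 0" "map_vec Im v $ i = 0" using assms(2,3) i by auto
  then show "v $ i = 0\<^sub>v n $ i" using assms(1) i by (simp add: complex_eq_iff)
qed (use assms(1) in auto)

text \<open>A locale because \<open>Q\<close> enters with two different constants \<open>c\<close>:
  a row-sum one and the cosine one.\<close>

locale symmetric_form_bounds =
  fixes A :: "real mat" and n :: nat and c :: real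
  assumes A: "A \<in> carrier_mat n n" and sym: "A\<^sup>T = A"
    and pos: "\<And>x. x \<in> carrier_vec n \<Longrightarrow> x \<noteq> 0\<^sub>v n \<Longrightarrow> 0 < x \<bullet> (A *\<^sub>v x)"
    and upper: "\<And>x. x \<in> carrier_vec n \<Longrightarrow> x \<bullet> (A *\<^sub>v x) \<le> c * (x \<bullet> x)"
begin

lemma complex_form_bounds:
  fixes v :: "complex vec"
  assumes v: "v \<in> carrier_vec n" "v \<noteq> 0\<^sub>v n"
  defines "N \<equiv> map_vec Re v \<bullet> map_vec Re v + map_vec Im v \<bullet> map_vec Im v"
  obtains q where "(map_mat complex_of_real A *\<^sub>v v) \<bullet>c v = complex_of_real q"
    "0 < q" "q \<le> c * N" "0 < N"
proof -
  let ?a = "map_vec Re v" and ?b = "map_vec Im v"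
  have ab: "?a \<in> carrier_vec n" "?b \<in> carrier_vec n" using v by auto
  \<comment> \<open>Strict positivity is not enough: the real or the imaginary part of a nonzero
    vector may be zero.\<close>
  have nn: "0 \<le> x \<bullet> (A *\<^sub>v x)" if "x \<in> carrier_vec n" for x
    using pos[OF that] that A by (cases "x = 0\<^sub>v n") (auto intro!: less_imp_le)
  have ne: "?a \<noteq> 0\<^sub>v n \<or> ?b \<noteq> 0\<^sub>v n" using map_vec_Re_Im_eq_0[OF v(1)] v(2) by blast
  have sp: "0 < x \<bullet> x" if "x \<in> carrier_vec n" "x \<noteq> 0\<^sub>v n" for x :: "real vec"
    using scalar_prod_self_nonneg[of x] scalar_prod_self_eq_0_iff[OF that(1)] that(2) by auto
  show thesis
  proof (rule that[OF complex_quadratic_form[OF A sym v(1)]])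
    show "0 < ?a \<bullet> (A *\<^sub>v ?a) + ?b \<bullet> (A *\<^sub>v ?b)"
      using ne pos nn ab by (meson add_nonneg_pos add_pos_nonneg)
    show "?a \<bullet> (A *\<^sub>v ?a) + ?b \<bullet> (A *\<^sub>v ?b) \<le> c * N"
      using upper[OF ab(1)] upper[OF ab(2)] by (simp add: N_def distrib_left)
    show "0 < N" unfolding N_def
      using ne sp ab scalar_prod_self_nonneg by (meson add_nonneg_pos add_pos_nonneg)
  qed
qed

lemma eigenvalue_bounds:
  assumes "eigenvalue (map_mat complex_of_real A) \<alpha>"
  shows "\<alpha> \<in> \<real> \<and> 0 < Re \<alpha> \<and> Re \<alpha> \<le> c"
proof -
  let ?A = "map_mat complex_of_real A"
  obtain v where v: "v \<in> carrier_vec n" "v \<noteq> 0\<^sub>v n" "?A *\<^sub>v v = \<alpha> \<cdot>\<^sub>v v"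
    using assms A by (auto simp: eigenvalue_def eigenvector_def)
  obtain q N where q: "(?A *\<^sub>v v) \<bullet>c v = complex_of_real q" "0 < q" "q \<le> c * N" "0 < N"
    and N: "v \<bullet>c v = complex_of_real N"
    using complex_form_bounds[OF v(1,2)] complex_scalar_prod_self[of v] by metis
  have "\<alpha> * complex_of_real N = complex_of_real q"
    using q(1) v(1) unfolding v(3) N[symmetric] by simp
  then have "\<alpha> = complex_of_real (q / N)" using q(4) by (simp add: field_simps)
  then show ?thesis using q by (simp add: divide_le_eq)
qed

lemma numerical_range_subset:
  "numerical_range (map_mat complex_of_real A) \<subseteq> complex_of_real ` {0 <.. c}"
proof
  let ?A = "map_mat complex_of_real A"
  fix z assume "z \<in> numerical_range ?A"
  then obtain v where v: "v \<in> carrier_vec n" "vec_norm2 v = 1" "z = (?A *\<^sub>v v) \<bullet>c v"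
    using A by (auto simp: numerical_range_def)
  have "v \<noteq> 0\<^sub>v n" using v(2) by (auto simp: vec_norm2_def)
  moreover have "map_vec Re v \<bullet> map_vec Re v + map_vec Im v \<bullet> map_vec Im v = 1"
    using v(2) by (simp add: vec_norm2_complex)
  ultimately obtain q where "z = complex_of_real q" "0 < q" "q \<le> c"
    using complex_form_bounds[OF v(1)] v(3) by (metis mult.right_neutral)
  then show "z \<in> complex_of_real ` {0 <.. c}" by auto
qed

end

section \<open>One-dimensional Wasserstein-1 matrices\<close>

lemma wass_mat_carrier: "wass_mat lam n \<in> carrier_mat n n"
  by (simp add: wass_mat_def)

lemma index_wass_mat:
  assumes "i < n" "j < n"
  shows "wass_mat lam n $$ (i, j) = (if j \<le> i then lam ^ (i - j) else lam ^ (j - i))"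
proof -
  have "nat \<bar>int i - int j\<bar> = (if j \<le> i then i - j else j - i)" by auto
  then show ?thesis using assms by (simp add: wass_mat_def)
qed

lemma wass_mat_decomposition:
  fixes lam n
  defines "L \<equiv> strict_lower (wass_mat lam n)"
  shows "wass_mat lam n = 1\<^sub>m n + (L + L\<^sup>T)"
  unfolding L_def
  by (rule eq_matI) (auto simp: strict_lower_def index_wass_mat wass_mat_carrier[THEN carrier_matD(1)]
      wass_mat_carrier[THEN carrier_matD(2)])

text \<open>\<open>L\<close> and its transpose have the same real quadratic form, hence the factor
  2.\<close>

lemma wass_mat_quadratic_le:
  fixes lam n
  defines "L \<equiv> strict_lower (wass_mat lam n)"
  assumes n: "0 < n" and x: "x \<in> carrier_vec n"
  shows "x \<bullet> (wass_mat lam n *\<^sub>v x)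
    \<le> (1 + 2 * op_norm vec_norm2 L * cos (pi / (real n + 1))) * (x \<bullet> x)"
proof -
  have L: "L \<in> carrier_mat n n" by (simp add: L_def strict_lower_def wass_mat_def)
  have LT: "x \<bullet> (L\<^sup>T *\<^sub>v x) = x \<bullet> (L *\<^sub>v x)"
    using scalar_prod_transpose[of "L\<^sup>T" n n x x] comm_scalar_prod[of "L *\<^sub>v x" n x] L x by simp
  have "wass_mat lam n *\<^sub>v x = x + (L *\<^sub>v x + L\<^sup>T *\<^sub>v x)"
    using L x unfolding wass_mat_decomposition[of lam n, folded L_def]
    by (simp add: add_mult_distrib_mat_vec[of _ n n])
  then have "x \<bullet> (wass_mat lam n *\<^sub>v x) = x \<bullet> x + 2 * (x \<bullet> (L *\<^sub>v x))"
    using L x by (simp add: scalar_prod_add_distrib[of _ n] LT)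
  moreover have "x \<bullet> (L *\<^sub>v x) \<le> op_norm vec_norm2 L * cos (pi / (real n + 1)) * (x \<bullet> x)"
    using L n x
    by (intro strictly_lower_triangular_numerical_radius l2_bound_op_norm2 op_norm2_nonneg)
      (auto simp: L_def strict_lower_def wass_mat_def)
  ultimately show ?thesis by (simp add: algebra_simps)
qed

text \<open>Cholesky factor read off from the stationary autoregression X_0 = e_0, X_i = lam X_(i-1)
  + sqrt(1 - lam^2) e_i with independent unit noise e_i: row i holds the coefficients of X_i, and
  X_i, X_j have covariance lam^|i-j|.\<close>

definition wass_factor :: "real \<Rightarrow> nat \<Rightarrow> real mat" where
  "wass_factor lam n = mat n n (\<lambda>(i, j).
     if j = 0 then lam ^ i else if j \<le> i then sqrt (1 - lam\<^sup>2) * lam ^ (i - j) else 0)"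

lemma wass_factor_carrier: "wass_factor lam n \<in> carrier_mat n n"
  by (simp add: wass_factor_def)

lemma wass_mat_eq_gram:
  assumes "\<bar>lam\<bar> \<le> 1"
  shows "wass_mat lam n = wass_factor lam n * (wass_factor lam n)\<^sup>T"
proof -
  have sq: "sqrt (1 - lam\<^sup>2) * sqrt (1 - lam\<^sup>2) = 1 - lam\<^sup>2"
    using assms by (simp add: abs_square_le_1)
  let ?M = "wass_factor lam n"
  have entry: "(\<Sum>k<n. ?M $$ (i, k) * ?M $$ (j, k)) = lam ^ (j - i)" if ij: "i \<le> j" "j < n" for i j
  proof -
    define d where "d = j - i"
    have j: "j = i + d" using ij by (simp add: d_def)
    have "(\<Sum>k<n. ?M $$ (i, k) * ?M $$ (j, k)) = (\<Sum>k<Suc i. ?M $$ (i, k) * ?M $$ (j, k))"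
      using ij by (intro sum.mono_neutral_right) (auto simp: wass_factor_def)
    \<comment> \<open>Column 0 lacks the square root. Up to lam^d it contributes lam^(2i), and the
      geometric sum over the other columns contributes 1 - lam^(2i).\<close>
    also have "\<dots> = ?M $$ (i, 0) * ?M $$ (j, 0) + (\<Sum>k<i. ?M $$ (i, Suc k) * ?M $$ (j, Suc k))"
      by (rule sum.lessThan_Suc_shift)
    also have "(\<Sum>k<i. ?M $$ (i, Suc k) * ?M $$ (j, Suc k))
        = (\<Sum>k<i. lam ^ d * ((1 - lam\<^sup>2) * (lam\<^sup>2) ^ (i - Suc k)))"
    proof (rule sum.cong)
      fix k assume "k \<in> {..<i}"
      then have k: "k < i" by simp
      have "?M $$ (i, Suc k) * ?M $$ (j, Suc k)
          = (sqrt (1 - lam\<^sup>2) * sqrt (1 - lam\<^sup>2)) * (lam ^ (i - Suc k) * lam ^ (j - Suc k))"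
        using k ij by (simp add: wass_factor_def)
      also have "j - Suc k = d + (i - Suc k)" using k by (simp add: j)
      then have "lam ^ (i - Suc k) * lam ^ (j - Suc k) = lam ^ d * (lam\<^sup>2) ^ (i - Suc k)"
        by (simp add: power_add power_mult[symmetric] mult_2)
      finally show "?M $$ (i, Suc k) * ?M $$ (j, Suc k) = lam ^ d * ((1 - lam\<^sup>2) * (lam\<^sup>2) ^ (i - Suc k))"
        unfolding sq by (simp only: mult.left_commute)
    qed simp
    also have "\<dots> = lam ^ d * ((1 - lam\<^sup>2) * (\<Sum>k<i. (lam\<^sup>2) ^ k))"
      by (simp add: sum_distrib_left[symmetric] sum.nat_diff_reindex[of "\<lambda>k. (lam\<^sup>2) ^ k"])
    also have "\<dots> = lam ^ d * (1 - (lam\<^sup>2) ^ i)"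
      by (simp add: one_diff_power_eq)
    also have "?M $$ (i, 0) * ?M $$ (j, 0) = lam ^ d * (lam\<^sup>2) ^ i"
      using ij by (simp add: wass_factor_def j power_add power_mult[symmetric] mult_2)
    finally show ?thesis by (simp add: d_def algebra_simps)
  qed
  show ?thesis
  proof (rule eq_matI)
    fix i j assume "i < dim_row (?M * ?M\<^sup>T)" "j < dim_col (?M * ?M\<^sup>T)"
    then have ij: "i < n" "j < n" by (auto simp: wass_factor_def)
    have "(?M * ?M\<^sup>T) $$ (i, j) = (\<Sum>k<n. ?M $$ (i, k) * ?M $$ (j, k))"
      using ij wass_factor_carrier[of lam n] by (simp add: scalar_prod_def lessThan_atLeast0)
    then show "wass_mat lam n $$ (i, j) = (?M * ?M\<^sup>T) $$ (i, j)"
      using entry[of i j] entry[of j i] ij by (simp add: index_wass_mat mult.commute)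
  qed (auto simp: wass_factor_def wass_mat_def)
qed

text \<open>A sum of three conditionals instead of nested ones, so that
  \<open>sum_tridiagonal\<close> evaluates a whole matrix product entry at once.\<close>

definition wass_inv :: "real \<Rightarrow> nat \<Rightarrow> real mat" where
  "wass_inv lam n = mat n n (\<lambda>(i, j).
     ((if i = j then if j = 0 \<or> Suc j = n then 1 else 1 + lam\<^sup>2 else 0)
      + (if i = Suc j then - lam else 0) + (if Suc i = j then - lam else 0)) / (1 - lam\<^sup>2))"

lemma wass_inv_carrier: "wass_inv lam n \<in> carrier_mat n n"
  by (simp add: wass_inv_def)

lemma wass_inv_symmetric:
  "i < n \<Longrightarrow> j < n \<Longrightarrow> wass_inv lam n $$ (i, j) = wass_inv lam n $$ (j, i)"
  by (auto simp: wass_inv_def)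

lemma sum_tridiagonal:
  fixes q :: "nat \<Rightarrow> real"
  assumes "j < n"
  shows "(\<Sum>k<n. q k * ((if k = j then d else 0) + (if k = Suc j then u else 0) + (if Suc k = j then l else 0)))
    = q j * d + (if Suc j < n then q (Suc j) * u else 0) + (if 0 < j then q (j - 1) * l else 0)"
proof -
  have 1: "(\<Sum>k<n. q k * (if k = j then d else 0)) = q j * d"
    using assms by (simp add: if_distrib[of "(*) _"] cong: if_cong)
  have 2: "(\<Sum>k<n. q k * (if k = Suc j then u else 0)) = (if Suc j < n then q (Suc j) * u else 0)"
    by (simp add: if_distrib[of "(*) _"] cong: if_cong)
  have "(\<Sum>k<n. q k * (if Suc k = j then l else 0)) = (\<Sum>k<n. if k = j - 1 \<and> 0 < j then q k * l else 0)"
    by (intro sum.cong) auto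
  also have "\<dots> = (if 0 < j then q (j - 1) * l else 0)"
    using assms by (cases "0 < j") auto
  finally show ?thesis using 1 2 by (simp add: distrib_left sum.distrib)
qed

text \<open>Rows of \<open>wass_mat\<close> are geometric on each side of the diagonal, so the
  three-term combination cancels off the diagonal. In an end column one neighbour is missing, and 1
  replaces 1 + lam^2. For n = 1 both ends coincide and the formula gives 1 / (1 - lam^2) where the
  inverse is 1; hence \<open>2 \<le> n\<close>.\<close>

lemma wass_mat_mult_inv:
  assumes lam: "lam\<^sup>2 \<noteq> 1" and n: "2 \<le> n"
  shows "wass_mat lam n * wass_inv lam n = 1\<^sub>m n"
proof (rule eq_matI)
  fix i j assume "i < dim_row (1\<^sub>m n :: real mat)" "j < dim_col (1\<^sub>m n :: real mat)"
  then have i: "i < n" and j: "j < n" by auto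
  define q where "q k = wass_mat lam n $$ (i, k)" for k
  define d where "d = (if j = 0 \<or> Suc j = n then 1 else 1 + lam\<^sup>2)"
  have "(wass_mat lam n * wass_inv lam n) $$ (i, j) = (\<Sum>k<n. q k * wass_inv lam n $$ (k, j))"
    using wass_mat_carrier[of lam n] wass_inv_carrier[of lam n] i j
    by (simp add: q_def scalar_prod_def lessThan_atLeast0)
  also have "\<dots> = (\<Sum>k<n. q k * ((if k = j then d else 0) + (if k = Suc j then - lam else 0)
      + (if Suc k = j then - lam else 0))) / (1 - lam\<^sup>2)"
    unfolding sum_divide_distrib
    by (intro sum.cong) (use j in \<open>auto simp: wass_inv_def d_def\<close>)
  also have "\<dots> = (q j * d + (if Suc j < n then q (Suc j) * - lam else 0)
      + (if 0 < j then q (j - 1) * - lam else 0)) / (1 - lam\<^sup>2)"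
    by (simp only: sum_tridiagonal[OF j])
  also have "\<dots> = (if i = j then 1 else 0)"
  proof -
    \<comment> \<open>The offset \<open>e\<close> replaces truncated differences in the exponents by
      sums.\<close>
    consider "i = j" | e where "i = Suc (j + e)" | e where "j = Suc (i + e)"
      by (metis less_imp_Suc_add linorder_neqE_nat)
    then have "q j * d + (if Suc j < n then q (Suc j) * - lam else 0)
        + (if 0 < j then q (j - 1) * - lam else 0) = (if i = j then 1 - lam\<^sup>2 else 0)"
    proof cases
      case 1
      then show ?thesis using i j n
        by (cases j) (auto simp: q_def d_def index_wass_mat power2_eq_square)
    next
      case 2
      then show ?thesis using i j n
        by (cases j) (auto simp: q_def d_def index_wass_mat power2_eq_square algebra_simps)
    next
      case 3
      then show ?thesis using i j n
        by (auto simp: q_def d_def index_wass_mat power2_eq_square algebra_simps)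
    qed
    then show ?thesis using lam by simp
  qed
  also have "\<dots> = (1\<^sub>m n :: real mat) $$ (i, j)" using i j by simp
  finally show "(wass_mat lam n * wass_inv lam n) $$ (i, j) = (1\<^sub>m n :: real mat) $$ (i, j)" .
qed (auto simp: wass_mat_def wass_inv_def)

lemma wass_inv_row_sum_abs_le:
  assumes lam: "0 < lam" "lam < 1" and i: "i < n"
  shows "(\<Sum>j<n. \<bar>wass_inv lam n $$ (i, j)\<bar>) \<le> (1 + lam) / (1 - lam)"
proof -
  have lam2: "lam\<^sup>2 < 1" using lam by (simp add: power_less_one_iff)
  define d where "d = (if i = 0 \<or> Suc i = n then 1 else 1 + lam\<^sup>2)"
  \<comment> \<open>The factor 1 gives the sum the shape of \<open>sum_tridiagonal\<close> for a
    constant \<open>q\<close>. An interior row yields 1 + lam^2 + 2 lam = (1 + lam)^2, and end rows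
    yield less.\<close>
  have "(\<Sum>j<n. \<bar>wass_inv lam n $$ (i, j)\<bar>)
      \<le> (\<Sum>j<n. 1 * ((if j = i then d else 0) + (if j = Suc i then lam else 0)
        + (if Suc j = i then lam else 0)) / (1 - lam\<^sup>2))"
    using i lam lam2 by (intro sum_mono) (auto simp: wass_inv_def d_def abs_divide)
  also have "\<dots> = (d + (if Suc i < n then lam else 0) + (if 0 < i then lam else 0)) / (1 - lam\<^sup>2)"
    unfolding sum_divide_distrib[symmetric] sum_tridiagonal[OF i, of "\<lambda>_. 1"] by simp
  also have "\<dots> \<le> (1 + lam)\<^sup>2 / (1 - lam\<^sup>2)"
    using lam lam2 by (intro divide_right_mono) (auto simp: d_def power2_eq_square algebra_simps)
  also have "\<dots> = (1 + lam) / (1 - lam)"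
  proof -
    have "1 - lam\<^sup>2 = (1 + lam) * (1 - lam)" by (simp add: power2_eq_square algebra_simps)
    then show ?thesis using lam by (simp add: power2_eq_square)
  qed
  finally show ?thesis .
qed

section \<open>Row sums and spectral norm bounds of one factor\<close>

lemma wass_mat_row_sum:
  assumes "lam \<noteq> 1" and i: "i < n"
  shows "(\<Sum>j<n. wass_mat lam n $$ (i, j)) = (1 + lam - lam ^ Suc i - lam ^ (n - i)) / (1 - lam)"
proof -
  define q where "q j = (if j \<le> i then lam ^ (i - j) else lam ^ (j - i))" for j
  have base: "(1 - lam) * (\<Sum>j<Suc i. q j) = 1 - lam ^ Suc i"
  proof -
    have "(\<Sum>j<Suc i. q j) = (\<Sum>j<Suc i. lam ^ (Suc i - Suc j))"
      by (intro sum.cong) (auto simp: q_def)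
    also have "\<dots> = (\<Sum>j<Suc i. lam ^ j)" by (rule sum.nat_diff_reindex)
    finally show ?thesis by (simp only: one_diff_power_eq)
  qed
  \<comment> \<open>\<open>d\<close> counts the entries to the right of the diagonal;
    \<open>base\<close> covers the others.\<close>
  have "(1 - lam) * (\<Sum>j<Suc i + d. q j) = 1 + lam - lam ^ Suc i - lam ^ Suc d" for d
  proof (induction d)
    case 0
    then show ?case using base by simp
  next
    case (Suc d)
    have "(\<Sum>j<Suc i + Suc d. q j) = (\<Sum>j<Suc i + d. q j) + lam ^ Suc d"
      by (simp add: q_def)
    then have "(1 - lam) * (\<Sum>j<Suc i + Suc d. q j)
        = (1 + lam - lam ^ Suc i - lam ^ Suc d) + (1 - lam) * lam ^ Suc d"
      by (simp only: distrib_left Suc)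
    then show ?case by (simp add: algebra_simps)
  qed
  from this[of "n - Suc i"] have "(1 - lam) * (\<Sum>j<n. q j) = 1 + lam - lam ^ Suc i - lam ^ (n - i)"
    using i by (simp add: Suc_diff_Suc del: power_Suc)
  then have "(\<Sum>j<n. q j) = (1 + lam - lam ^ Suc i - lam ^ (n - i)) / (1 - lam)"
    using assms(1) by (simp add: eq_divide_eq mult.commute)
  then show ?thesis using i by (simp add: index_wass_mat q_def)
qed

lemma wass_mat_row_sum_abs_le:
  assumes lam: "0 < lam" "lam < 1" and i: "i < n" and n2: "2 \<le> n"
  shows "(\<Sum>j<n. \<bar>wass_mat lam n $$ (i, j)\<bar>) \<le> (1 + lam) * (1 - lam ^ (n - 1)) / (1 - lam)"
proof -
  have "(\<Sum>j<n. \<bar>wass_mat lam n $$ (i, j)\<bar>) = (\<Sum>j<n. wass_mat lam n $$ (i, j))"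
    using lam i by (intro sum.cong) (auto simp: index_wass_mat)
  also have "\<dots> = (1 + lam - lam ^ Suc i - lam ^ (n - i)) / (1 - lam)"
    using lam by (intro wass_mat_row_sum i) simp
  also have "\<dots> \<le> (1 + lam) * (1 - lam ^ (n - 1)) / (1 - lam)"
  proof (intro divide_right_mono)
    have n: "lam * lam ^ (n - 1) = lam ^ n" using i by (simp add: power_eq_if)
    have dec: "lam ^ a \<le> lam ^ b" if "b \<le> a" for a b
      using that lam by (intro power_decreasing) auto
    \<comment> \<open>Compare exponents termwise: for i > 0, n - i is at most n - 1 and i + 1 at
      most n. For i = 0 the exponents are 1 and n, and \<open>2 \<le> n\<close> is needed.\<close>
    have "lam ^ (n - 1) + lam ^ n \<le> lam ^ Suc i + lam ^ (n - i)"
    proof (cases i)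
      case 0
      then show ?thesis using dec[of 1 "n - 1"] n2 by simp
    next
      case (Suc i')
      have "lam ^ (n - 1) \<le> lam ^ (n - i)" "lam ^ n \<le> lam ^ Suc i"
        using Suc i by (intro dec; simp)+
      then show ?thesis by simp
    qed
    then show "1 + lam - lam ^ Suc i - lam ^ (n - i) \<le> (1 + lam) * (1 - lam ^ (n - 1))"
      using n by (simp add: algebra_simps)
  qed (use lam in simp)
  finally show ?thesis .
qed

lemma wass_mat_symmetric: "(wass_mat lam n)\<^sup>T = wass_mat lam n"
  by (rule transpose_eqI[OF wass_mat_carrier]) (auto simp: index_wass_mat)

lemma wass_mat_l2_bound_row_sum:
  assumes lam: "0 < lam" "lam < 1" and n: "2 \<le> n"
  shows "l2_bound (wass_mat lam n) ((1 + lam) * (1 - lam ^ (n - 1)) / (1 - lam))"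
proof (rule l2_bound_symmetric_row_sum[OF wass_mat_carrier])
  show "0 \<le> (1 + lam) * (1 - lam ^ (n - 1)) / (1 - lam)"
    using lam by (simp add: power_le_one)
qed (use lam n wass_mat_row_sum_abs_le in \<open>auto simp: index_wass_mat\<close>)

lemma cos_pi_over_Suc_nonneg:
  assumes "1 \<le> n"
  shows "0 \<le> cos (pi / (real n + 1))"
proof (rule cos_ge_zero)
  have "pi * 2 \<le> pi * (real n + 1)" using assms by (intro mult_left_mono) auto
  then show "pi / (real n + 1) \<le> pi / 2" by (simp add: field_simps)
  show "- (pi / 2) \<le> pi / (real n + 1)" using pi_gt_zero
    by (smt (verit) divide_nonneg_nonneg of_nat_0_le_iff)
qed

text \<open>Semidefiniteness, from the Gram factorization, upgrades the form bound of
  \<open>wass_mat_quadratic_le\<close> to a norm bound, which passes to Kronecker products.\<close>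

lemma wass_mat_l2_bound_cos:
  fixes lam n
  defines "t \<equiv> op_norm vec_norm2 (strict_lower (wass_mat lam n))"
  assumes lam: "\<bar>lam\<bar> \<le> 1" and n: "1 \<le> n"
  shows "0 \<le> t" and "l2_bound (wass_mat lam n) (1 + 2 * t * cos (pi / (real n + 1)))"
proof -
  show t: "0 \<le> t" unfolding t_def
    using n by (intro op_norm2_nonneg) (simp add: strict_lower_def wass_mat_def)
  have "0 \<le> 1 + 2 * t * cos (pi / (real n + 1))"
    using t n cos_pi_over_Suc_nonneg by simp
  moreover have "x \<bullet> (wass_mat lam n *\<^sub>v x) \<le> (1 + 2 * t * cos (pi / (real n + 1))) * (x \<bullet> x)"
    if "x \<in> carrier_vec n" for x
    using wass_mat_quadratic_le[OF _ that] n by (simp add: t_def)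
  ultimately show "l2_bound (wass_mat lam n) (1 + 2 * t * cos (pi / (real n + 1)))"
    unfolding wass_mat_eq_gram[OF lam] by (intro l2_bound_gram[OF wass_factor_carrier])
qed

text \<open>The first entry weakens the cosine bound by cos <= 1. The other two exceed the row-sum
  bound: 1 + lam <= 3 - lam for one, a factor 2 for the other.\<close>

lemma wass_mat_l2_bound_Min:
  fixes lam n
  assumes lam: "0 < lam" "lam < 1" and n: "2 \<le> n"
  defines "M \<equiv> Min {1 + 2 * op_norm vec_norm2 (strict_lower (wass_mat lam n)),
                   (3 - lam) / (1 - lam),
                   2 * (1 + lam) * (1 - lam ^ (n - 1)) / (1 - lam)}"
  shows "l2_bound (wass_mat lam n) M" and "0 \<le> M"
proof -
  let ?t = "op_norm vec_norm2 (strict_lower (wass_mat lam n))"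
  let ?b = "(1 + lam) * (1 - lam ^ (n - 1)) / (1 - lam)"
  have lamn: "0 < lam ^ (n - 1)" "lam ^ (n - 1) \<le> 1" using lam by (auto simp: power_le_one)
  have b: "0 \<le> ?b" using lam lamn by simp
  have t: "0 \<le> ?t" using wass_mat_l2_bound_cos(1)[of lam n] lam n by simp
  have c: "0 \<le> cos (pi / (real n + 1))" using n by (intro cos_pi_over_Suc_nonneg) simp
  have "l2_bound (wass_mat lam n) (1 + 2 * ?t)"
  proof (rule l2_bound_mono[OF wass_mat_l2_bound_cos(2)])
    show "1 + 2 * ?t * cos (pi / (real n + 1)) \<le> 1 + 2 * ?t"
      using t by (simp add: mult_left_le)
  qed (use t c lam n in auto)
  moreover have "l2_bound (wass_mat lam n) ((3 - lam) / (1 - lam))"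
  proof (rule l2_bound_mono[OF wass_mat_l2_bound_row_sum[OF lam n] b])
    have "(1 + lam) * (1 - lam ^ (n - 1)) \<le> (1 + lam) * 1"
      using lam lamn by (intro mult_left_mono) auto
    also have "\<dots> \<le> 3 - lam" using lam by simp
    finally show "?b \<le> (3 - lam) / (1 - lam)" using lam by (intro divide_right_mono) auto
  qed
  moreover have "l2_bound (wass_mat lam n) (2 * (1 + lam) * (1 - lam ^ (n - 1)) / (1 - lam))"
  proof (rule l2_bound_mono[OF wass_mat_l2_bound_row_sum[OF lam n] b])
    have "1 * ?b \<le> 2 * ?b" by (intro mult_right_mono b) simp
    then show "?b \<le> 2 * (1 + lam) * (1 - lam ^ (n - 1)) / (1 - lam)"
      by (simp only: mult_1 times_divide_eq_right mult.assoc)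
  qed
  ultimately show "l2_bound (wass_mat lam n) M"
    unfolding M_def by (simp add: min_def)
  show "0 \<le> M" unfolding M_def using t lam lamn by simp
qed

lemma wass_inv_l2_bound:
  assumes lam: "0 < lam" "lam < 1"
  shows "l2_bound (wass_inv lam n) ((1 + lam) / (1 - lam))"
  using lam wass_inv_symmetric wass_inv_row_sum_abs_le[OF lam]
  by (intro l2_bound_symmetric_row_sum[OF wass_inv_carrier]) auto

text \<open>The leading 2-by-2 block has eigenvalue 1 + lam at (1, 1); padding that vector with
  zeros keeps the quotient.\<close>

lemma wass_mat_Rayleigh_quotient:
  assumes n: "2 \<le> n"
  obtains u where "u \<in> carrier_vec n" "u \<bullet> u = 2" "u \<bullet> (wass_mat lam n *\<^sub>v u) = 2 * (1 + lam)"
proof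
  let ?u = "unit_vec n 0 + unit_vec n 1 :: real vec"
  show u: "?u \<in> carrier_vec n" by simp
  have sp: "?u \<bullet> v = v $ 0 + v $ 1" if "v \<in> carrier_vec n" for v
    using that n by (subst add_scalar_prod_distrib[of _ n]) (auto simp: scalar_prod_left_unit)
  show "?u \<bullet> ?u = 2" using n by (subst sp) auto
  have "(wass_mat lam n *\<^sub>v ?u) $ i = wass_mat lam n $$ (i, 0) + wass_mat lam n $$ (i, 1)"
    if i: "i < n" for i
  proof -
    have "(wass_mat lam n *\<^sub>v ?u) $ i = ?u \<bullet> row (wass_mat lam n) i"
      using wass_mat_carrier[of lam n] i
      by (simp add: comm_scalar_prod[of _ n])
    also have "\<dots> = wass_mat lam n $$ (i, 0) + wass_mat lam n $$ (i, 1)"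
      using wass_mat_carrier[of lam n] i n by (subst sp) auto
    finally show ?thesis .
  qed
  then show "?u \<bullet> (wass_mat lam n *\<^sub>v ?u) = 2 * (1 + lam)"
    using wass_mat_carrier[of lam n] n
    by (subst sp) (auto simp: index_wass_mat simp del: index_mult_mat_vec)
qed

text \<open>Since lam^n <= lam, the left side is at most its value with lam in place of lam^n, which
  is exactly the entry 1 / (1 - lam^2).\<close>

lemma wass_inv_00_ge:
  assumes lam: "0 < lam" "lam < 1" and n: "2 \<le> n"
  shows "(1 - lam) / ((1 + lam) * (1 - lam ^ n)\<^sup>2) \<le> wass_inv lam n $$ (0, 0)"
proof -
  have "lam ^ n \<le> lam ^ 1" using lam n by (intro power_decreasing) auto
  then have "(1 - lam)\<^sup>2 \<le> (1 - lam ^ n)\<^sup>2" using lam by (intro power_mono) auto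
  then have "(1 - lam) / ((1 + lam) * (1 - lam ^ n)\<^sup>2) \<le> (1 - lam) / ((1 + lam) * (1 - lam)\<^sup>2)"
    using lam by (intro divide_left_mono mult_left_mono mult_pos_pos)
      (auto simp: power_less_one_iff intro!: zero_less_power)
  also have "\<dots> = 1 / (1 - lam\<^sup>2)"
  proof -
    have "1 - lam\<^sup>2 = (1 + lam) * (1 - lam)" by (simp add: power2_eq_square algebra_simps)
    then show ?thesis using lam by (simp add: power2_eq_square)
  qed
  also have "\<dots> = wass_inv lam n $$ (0, 0)" using n by (simp add: wass_inv_def)
  finally show ?thesis .
qed

lemma wass_inv_00_ge_1:
  assumes lam: "0 < lam" "lam < 1" and n: "2 \<le> n"
  shows "1 \<le> wass_inv lam n $$ (0, 0)"
  using lam n by (simp add: wass_inv_def power_less_one_iff)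

section \<open>The two-dimensional matrix\<close>

theorem theorem3p9:
  fixes n m :: nat and lam1 lam2 m1 m2 :: real
    and Q1 Q2 L1 L2 Q :: "real mat" and Qc :: "complex mat"
  assumes "n \<ge> 2" and "m \<ge> 2"
    and "0 < lam1" and "lam1 < 1" and "0 < lam2" and "lam2 < 1"
    and "Q1 = wass_mat lam1 n" and "Q2 = wass_mat lam2 m"
    and "L1 = strict_lower Q1" and "L2 = strict_lower Q2"
    and "Q = kronecker Q2 Q1" and "Qc = map_mat complex_of_real Q"
    and "m1 = Min {1 + 2 * op_norm vec_norm2 L1,
                   (3 - lam1) / (1 - lam1),
                   2 * (1 + lam1) * (1 - lam1 ^ (n - 1)) / (1 - lam1)}"
    and "m2 = Min {1 + 2 * op_norm vec_norm2 L2,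
                   (3 - lam2) / (1 - lam2),
                   2 * (1 + lam2) * (1 - lam2 ^ (m - 1)) / (1 - lam2)}"
  shows
    "(lam1 \<le> 1 / 3 \<and> lam2 \<le> 1 / 3 \<longrightarrow>
        (\<forall>\<alpha>. eigenvalue Qc \<alpha> \<longrightarrow> \<alpha> \<in> \<real> \<and> 0 < Re \<alpha> \<and> Re \<alpha> < 4))
   \<and> (\<forall>\<alpha>. eigenvalue Qc \<alpha> \<longrightarrow> \<alpha> \<in> \<real> \<and> 0 < Re \<alpha> \<and>
        Re \<alpha> \<le> (1 + 2 * op_norm vec_norm2 L1 * cos (pi / (real n + 1)))
              * (1 + 2 * op_norm vec_norm2 L2 * cos (pi / (real m + 1))))
   \<and> spectral_radius Qc \<ge> (1 + lam1) * (1 + lam2)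
   \<and> numerical_range Qc \<subseteq> complex_of_real `
        {0 <.. (1 + lam1) * (1 + lam2) * (1 - lam1 ^ (n - 1)) * (1 - lam2 ^ (m - 1))
               / ((1 - lam1) * (1 - lam2))}
   \<and> (1 / ((1 + lam1)\<^sup>2 * (1 + lam2)\<^sup>2) \<le> op_norm vec_norm1 Q
      \<and> op_norm vec_norm1 Q = op_norm vec_norm_inf Q
      \<and> op_norm vec_norm_inf Q \<le> (1 + 2 * lam1 * (1 - lam1 ^ (n - 1)) / (1 - lam1))
                                * (1 + 2 * lam2 * (1 - lam2 ^ (m - 1)) / (1 - lam2)))
   \<and> (1 / ((1 + lam1)\<^sup>2 * (1 + lam2)\<^sup>2) \<le> op_norm vec_norm2 Q
      \<and> op_norm vec_norm2 Q \<le> m1 * m2)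
   \<and> (op_norm vec_norm1 (mat_inv Q) = op_norm vec_norm_inf (mat_inv Q)
      \<and> op_norm vec_norm_inf (mat_inv Q) \<ge>
          (1 - lam1) * (1 - lam2)
          / ((1 + lam1) * (1 + lam2) * (1 - lam1 ^ n)\<^sup>2 * (1 - lam2 ^ m)\<^sup>2))
   \<and> ((1 - lam1) * (1 - lam2) / ((1 + lam1) * (1 + lam2)) \<le> op_norm vec_norm2 (mat_inv Q)
      \<and> op_norm vec_norm2 (mat_inv Q) \<le> (1 + lam1) * (1 + lam2) / ((1 - lam1) * (1 - lam2)))
   \<and> ((1 - lam1) * (1 - lam2)
        / ((1 + lam1) ^ 3 * (1 + lam2) ^ 3 * (1 - lam1 ^ n)\<^sup>2 * (1 - lam2 ^ m)\<^sup>2)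
        \<le> cond_num vec_norm1 Q
      \<and> cond_num vec_norm1 Q = cond_num vec_norm_inf Q
      \<and> cond_num vec_norm_inf Q \<le>
          (1 + lam1) * (1 + lam2) * (1 - lam1 + 2 * lam1 * (1 - lam1 ^ (n - 1)))
            * (1 - lam2 + 2 * lam2 * (1 - lam2 ^ (m - 1)))
          / ((1 - lam1)\<^sup>2 * (1 - lam2)\<^sup>2))
   \<and> ((1 - lam1) * (1 - lam2) / ((1 + lam1) ^ 3 * (1 + lam2) ^ 3) \<le> cond_num vec_norm2 Q
      \<and> cond_num vec_norm2 Q \<le>
          m1 * m2 * ((1 + lam1) * (1 + lam2) / ((1 - lam1) * (1 - lam2))))"
proof -
  note lam1 = assms(3,4) and lam2 = assms(5,6)
  have n: "2 \<le> n" and m: "2 \<le> m" using assms by auto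
  have Q1: "Q1 \<in> carrier_mat n n" and Q2: "Q2 \<in> carrier_mat m m"
    using assms wass_mat_carrier by auto
  define P1 where "P1 = wass_inv lam1 n"
  define P2 where "P2 = wass_inv lam2 m"
  have P1: "P1 \<in> carrier_mat n n" and P2: "P2 \<in> carrier_mat m m"
    using wass_inv_carrier by (auto simp: P1_def P2_def)
  define P where "P = kronecker P2 P1"
  have Q: "Q \<in> carrier_mat (m * n) (m * n)" and P: "P \<in> carrier_mat (m * n) (m * n)"
    using kronecker_carrier Q1 Q2 P1 P2 assms by (auto simp: P_def)
  have N: "0 < m * n" using n m by simp
  have lamsq: "lam1\<^sup>2 \<noteq> 1" "lam2\<^sup>2 \<noteq> 1" using lam1 lam2 by (auto simp: power2_eq_1_iff)
  have inv: "Q1 * P1 = 1\<^sub>m n" "Q2 * P2 = 1\<^sub>m m"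
    using wass_mat_mult_inv lamsq n m assms by (auto simp: P1_def P2_def)
  have QP: "Q * P = 1\<^sub>m (m * n)"
    using kronecker_mult[OF Q2 Q1 P2 P1] inv assms by (simp add: P_def kronecker_one)
  have invQ: "mat_inv Q = P" by (rule mat_inv_eq[OF Q P QP])
  have PQ: "P * Q = 1\<^sub>m (m * n)" by (rule mat_mult_left_right_inverse[OF Q P QP])
  have symQ: "Q\<^sup>T = Q"
    using wass_mat_symmetric assms by (simp add: transpose_kronecker)
  have symP: "P\<^sup>T = P"
    unfolding P_def transpose_kronecker P1_def P2_def
    by (simp add: transpose_eqI[OF wass_inv_carrier wass_inv_symmetric])

  \<comment> \<open>Positive definiteness and form bounds of \<open>Q\<close>\<close>
  define K where "K = kronecker (wass_factor lam2 m) (wass_factor lam1 n)"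
  have K: "K \<in> carrier_mat (m * n) (m * n)"
    unfolding K_def by (intro kronecker_carrier wass_factor_carrier)
  have QK: "Q = K * K\<^sup>T"
    unfolding K_def transpose_kronecker assms(7,8,11)
    using lam1 lam2 wass_mat_eq_gram[of lam1 n] wass_mat_eq_gram[of lam2 m]
      kronecker_mult[OF wass_factor_carrier wass_factor_carrier
        transpose_carrier_mat[THEN iffD2, OF wass_factor_carrier]
        transpose_carrier_mat[THEN iffD2, OF wass_factor_carrier], of lam2 m lam1 n lam2 lam1]
    by simp
  have pos: "0 < x \<bullet> (Q *\<^sub>v x)" if x: "x \<in> carrier_vec (m * n)" "x \<noteq> 0\<^sub>v (m * n)" for x
  proof -
    have form: "x \<bullet> (Q *\<^sub>v x) = (K\<^sup>T *\<^sub>v x) \<bullet> (K\<^sup>T *\<^sub>v x)"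
      unfolding QK by (rule scalar_prod_gram[OF K x(1) x(1)])
    have Kx: "K\<^sup>T *\<^sub>v x \<in> carrier_vec (m * n)" using K x by auto
    \<comment> \<open>The Gram form gives only semidefiniteness; strictness comes from invertibility
      of \<open>Q\<close>.\<close>
    have "K\<^sup>T *\<^sub>v x \<noteq> 0\<^sub>v (m * n)"
    proof
      assume zero: "K\<^sup>T *\<^sub>v x = 0\<^sub>v (m * n)"
      have "x = (P * Q) *\<^sub>v x" using PQ x by simp
      also have "\<dots> = P *\<^sub>v (Q *\<^sub>v x)" using P Q x(1) by (rule assoc_mult_mat_vec)
      also have "Q *\<^sub>v x = K *\<^sub>v (K\<^sup>T *\<^sub>v x)"
        unfolding QK using K x(1) by (intro assoc_mult_mat_vec[of _ "m * n" "m * n" _ "m * n"]) auto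
      also have "P *\<^sub>v (K *\<^sub>v (K\<^sup>T *\<^sub>v x)) = 0\<^sub>v (m * n)"
        unfolding zero using P K by (auto intro!: eq_vecI simp: scalar_prod_def)
      finally show False using x(2) by simp
    qed
    then show ?thesis
      using scalar_prod_self_eq_0_iff[OF Kx] scalar_prod_self_nonneg[of "K\<^sup>T *\<^sub>v x"] form by simp
  qed
  have bounds: "symmetric_form_bounds Q (m * n) c" if "l2_bound Q c" "0 \<le> c" for c
    using Q symQ pos l2_bound_quadratic[OF that Q] by unfold_locales

  define b1 where "b1 = (1 + lam1) * (1 - lam1 ^ (n - 1)) / (1 - lam1)"
  define b2 where "b2 = (1 + lam2) * (1 - lam2 ^ (m - 1)) / (1 - lam2)"
  have l2b: "l2_bound Q (b2 * b1)"
    unfolding assms(11) b1_def b2_def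
    using wass_mat_l2_bound_row_sum[OF lam1 n] wass_mat_l2_bound_row_sum[OF lam2 m] assms(7,8)
    by (intro l2_bound_kronecker[OF Q2 Q1]) simp_all
  have b_nonneg: "0 \<le> b1" "0 \<le> b2"
    using lam1 lam2 by (auto simp: b1_def b2_def power_le_one)
  \<comment> \<open>The row-sum constant, for (i) and (iv).\<close>
  interpret B: symmetric_form_bounds Q "m * n" "b2 * b1"
    using b_nonneg by (intro bounds l2b) simp

  \<comment> \<open>Eigenvalues, spectral radius and numerical range\<close>
  have i: "\<alpha> \<in> \<real> \<and> 0 < Re \<alpha> \<and> Re \<alpha> < 4"
    if "lam1 \<le> 1 / 3" "lam2 \<le> 1 / 3" "eigenvalue Qc \<alpha>" for \<alpha>
  proof -
    \<comment> \<open>The threshold 1/3 is where (1 + l) / (1 - l) reaches 2; strictness comes from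
      l^k > 0.\<close>
    have less2: "(1 + l) * (1 - l ^ k) / (1 - l) < 2" if "0 < l" "l \<le> 1 / 3" for l :: real and k
    proof -
      have "(1 + l) * (1 - l ^ k) < (1 + l) * 1"
        using that by (intro mult_strict_left_mono) auto
      also have "\<dots> \<le> 2 * (1 - l)" using that by simp
      finally show ?thesis using that by (simp add: divide_less_eq)
    qed
    have "b2 * b1 < 2 * 2"
      unfolding b1_def b2_def using b_nonneg lam1 lam2 that
      by (intro mult_strict_mono' less2) (auto simp: b1_def b2_def)
    then show ?thesis using B.eigenvalue_bounds that(3) assms(12) by fastforce
  qed

  have ii: "\<alpha> \<in> \<real> \<and> 0 < Re \<alpha> \<and>
        Re \<alpha> \<le> (1 + 2 * op_norm vec_norm2 L1 * cos (pi / (real n + 1)))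
              * (1 + 2 * op_norm vec_norm2 L2 * cos (pi / (real m + 1)))"
    if "eigenvalue Qc \<alpha>" for \<alpha>
  proof -
    let ?c1 = "1 + 2 * op_norm vec_norm2 L1 * cos (pi / (real n + 1))"
    let ?c2 = "1 + 2 * op_norm vec_norm2 L2 * cos (pi / (real m + 1))"
    have c1: "l2_bound Q1 ?c1" "0 \<le> ?c1"
      using wass_mat_l2_bound_cos[of lam1 n] cos_pi_over_Suc_nonneg[of n] n lam1 assms by auto
    have c2: "l2_bound Q2 ?c2" "0 \<le> ?c2"
      using wass_mat_l2_bound_cos[of lam2 m] cos_pi_over_Suc_nonneg[of m] m lam2 assms by auto
    interpret C: symmetric_form_bounds Q "m * n" "?c2 * ?c1"
      using l2_bound_kronecker[OF Q2 Q1 c2(1) c1(1)] c1 c2 assms(11) by (intro bounds) auto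
    show ?thesis using C.eigenvalue_bounds[of \<alpha>] that assms(12) by (simp add: mult.commute)
  qed

  have iii: "spectral_radius Qc \<ge> (1 + lam1) * (1 + lam2)"
  proof -
    obtain u1 where u1: "u1 \<in> carrier_vec n" "u1 \<bullet> u1 = 2" "u1 \<bullet> (Q1 *\<^sub>v u1) = 2 * (1 + lam1)"
      using wass_mat_Rayleigh_quotient[OF n] assms(7) by metis
    obtain u2 where u2: "u2 \<in> carrier_vec m" "u2 \<bullet> u2 = 2" "u2 \<bullet> (Q2 *\<^sub>v u2) = 2 * (1 + lam2)"
      using wass_mat_Rayleigh_quotient[OF m] assms(8) by metis
    \<comment> \<open>Rayleigh quotients multiply on product vectors, so this one has quotient (1 +
      lam1)(1 + lam2).\<close>
    let ?x = "kron_vec u2 u1"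
    have x: "?x \<in> carrier_vec (m * n)" using u1 u2 by (auto simp: kron_vec_def)
    have xx: "?x \<bullet> ?x = 4" using u1 u2 by (simp add: scalar_prod_kron_vec)
    then have "?x \<noteq> 0\<^sub>v (m * n)" by auto
    moreover have "?x \<bullet> (Q *\<^sub>v ?x) = (2 * (1 + lam2)) * (2 * (1 + lam1))"
      unfolding assms(11) kronecker_mult_kron_vec[OF Q2 Q1 u2(1) u1(1)]
      using u1 u2 Q1 Q2 by (subst scalar_prod_kron_vec) auto
    ultimately show ?thesis
      unfolding assms(12) using lam1 lam2 xx
      by (intro spectral_radius_ge_Rayleigh_quotient[OF Q symQ x]) (auto simp: algebra_simps intro!: add_pos_pos)
  qed

  have iv: "numerical_range Qc \<subseteq> complex_of_real `
        {0 <.. (1 + lam1) * (1 + lam2) * (1 - lam1 ^ (n - 1)) * (1 - lam2 ^ (m - 1))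
               / ((1 - lam1) * (1 - lam2))}"
  proof -
    have "b2 * b1 = (1 + lam1) * (1 + lam2) * (1 - lam1 ^ (n - 1)) * (1 - lam2 ^ (m - 1))
               / ((1 - lam1) * (1 - lam2))" by (simp add: b1_def b2_def mult_ac)
    then show ?thesis using B.numerical_range_subset assms(12) by simp
  qed

  \<comment> \<open>Norms of \<open>Q\<close>\<close>
  have Q00: "\<bar>Q $$ (0, 0)\<bar> = 1"
    using index_kronecker[OF Q2 Q1, of 0 0] N n m assms by (simp add: index_wass_mat)
  have P00: "P $$ (0, 0) = P2 $$ (0, 0) * P1 $$ (0, 0)"
    using index_kronecker[OF P2 P1, of 0 0] N by (simp add: P_def)
  \<comment> \<open>The lower bounds in (v) and (vi) follow by comparing their constant with the
    diagonal entry 1.\<close>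
  have le1: "1 / ((1 + lam1)\<^sup>2 * (1 + lam2)\<^sup>2) \<le> 1"
    using lam1 lam2 mult_mono[of 1 "(1 + lam1)\<^sup>2" 1 "(1 + lam2)\<^sup>2"] by (simp add: one_le_power divide_le_eq)

  have v1: "1 / ((1 + lam1)\<^sup>2 * (1 + lam2)\<^sup>2) \<le> op_norm vec_norm1 Q"
    and v2: "op_norm vec_norm1 Q = op_norm vec_norm_inf Q"
  proof -
    show v2: "op_norm vec_norm1 Q = op_norm vec_norm_inf Q"
      by (rule op_norm1_eq_op_norm_inf_symmetric[OF Q N symQ])
    show "1 / ((1 + lam1)\<^sup>2 * (1 + lam2)\<^sup>2) \<le> op_norm vec_norm1 Q"
      using abs_entry_le_op_norm_inf[OF Q N N] Q00 le1 v2 by simp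
  qed
  define r1 where "r1 = 1 + 2 * lam1 * (1 - lam1 ^ (n - 1)) / (1 - lam1)"
  define r2 where "r2 = 1 + 2 * lam2 * (1 - lam2 ^ (m - 1)) / (1 - lam2)"
  \<comment> \<open>After multiplication by 1 - l the two sides differ by l^k (1 - l). The right
    side is 1 + 2(l + ... + l^k).\<close>
  have row_bound: "(1 + l) * (1 - l ^ k) / (1 - l) \<le> 1 + 2 * l * (1 - l ^ k) / (1 - l)"
    if "0 < l" "l < 1" for l :: real and k
  proof -
    have "0 \<le> l ^ k * (1 - l)" using that by simp
    then have "(1 + l) * (1 - l ^ k) \<le> (1 - l) + 2 * l * (1 - l ^ k)"
      by (simp add: algebra_simps)
    then have "(1 + l) * (1 - l ^ k) / (1 - l) \<le> ((1 - l) + 2 * l * (1 - l ^ k)) / (1 - l)"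
      using that by (intro divide_right_mono) auto
    then show ?thesis using that by (simp add: add_divide_distrib)
  qed
  have v3: "op_norm vec_norm_inf Q \<le> r1 * r2"
  proof (rule op_norm_inf_le[OF Q N])
    fix i assume i: "i < m * n"
    have "(\<Sum>j<m * n. \<bar>Q $$ (i, j)\<bar>)
        = (\<Sum>a<m. \<bar>Q2 $$ (i div n, a)\<bar>) * (\<Sum>b<n. \<bar>Q1 $$ (i mod n, b)\<bar>)"
      unfolding assms(11) by (rule kronecker_row_sum_abs[OF Q2 Q1 i])
    also have "\<dots> \<le> b2 * b1"
      unfolding b1_def b2_def assms(7,8) using i lam1 lam2 n m b_nonneg
      by (intro mult_mono wass_mat_row_sum_abs_le)
        (auto simp: less_mult_imp_div_less b2_def intro: sum_nonneg)
    also have "\<dots> \<le> r2 * r1"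
    proof (rule mult_mono)
      show "b2 \<le> r2" "b1 \<le> r1"
        using row_bound lam1 lam2 by (auto simp: b1_def b2_def r1_def r2_def)
      then show "0 \<le> r2" using b_nonneg by linarith
    qed (rule b_nonneg)
    finally show "(\<Sum>j<m * n. \<bar>Q $$ (i, j)\<bar>) \<le> r1 * r2" by (simp add: mult.commute)
  qed

  have vi1: "1 / ((1 + lam1)\<^sup>2 * (1 + lam2)\<^sup>2) \<le> op_norm vec_norm2 Q"
    using abs_entry_le_op_norm2[OF Q N N] Q00 le1 by simp
  have vi2: "op_norm vec_norm2 Q \<le> m1 * m2"
  proof (rule op_norm2_le)
    have "l2_bound Q (m2 * m1)"
      unfolding assms(11)
      using wass_mat_l2_bound_Min(1)[OF lam1 n] wass_mat_l2_bound_Min(1)[OF lam2 m] assms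
      by (intro l2_bound_kronecker[OF Q2 Q1]) auto
    then show "l2_bound Q (m1 * m2)" by (simp add: mult.commute)
    show "0 \<le> m1 * m2"
      using wass_mat_l2_bound_Min(2)[OF lam1 n] wass_mat_l2_bound_Min(2)[OF lam2 m] assms
      by (intro mult_nonneg_nonneg) auto
  qed (use Q N in simp)

  \<comment> \<open>Norms of the inverse\<close>
  let ?w = "(1 - lam1) * (1 - lam2)
          / ((1 + lam1) * (1 + lam2) * (1 - lam1 ^ n)\<^sup>2 * (1 - lam2 ^ m)\<^sup>2)"
  have vii1: "op_norm vec_norm1 P = op_norm vec_norm_inf P"
    by (rule op_norm1_eq_op_norm_inf_symmetric[OF P N symP])
  have vii2: "?w \<le> op_norm vec_norm_inf P"
  proof -
    have "?w = (1 - lam2) / ((1 + lam2) * (1 - lam2 ^ m)\<^sup>2) * ((1 - lam1) / ((1 + lam1) * (1 - lam1 ^ n)\<^sup>2))"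
      by (simp add: mult_ac)
    also have "\<dots> \<le> P2 $$ (0, 0) * P1 $$ (0, 0)"
      unfolding P1_def P2_def
      using wass_inv_00_ge[OF lam1 n] wass_inv_00_ge[OF lam2 m] wass_inv_00_ge_1[OF lam2 m] lam1
      by (intro mult_mono) auto
    also have "\<dots> \<le> op_norm vec_norm_inf P"
      using abs_entry_le_op_norm_inf[OF P N N] P00 by linarith
    finally show ?thesis .
  qed

  let ?k = "(1 + lam1) * (1 + lam2) / ((1 - lam1) * (1 - lam2))"
  have k_eq: "?k = (1 + lam2) / (1 - lam2) * ((1 + lam1) / (1 - lam1))" by (simp add: mult_ac)
  have viii1: "(1 - lam1) * (1 - lam2) / ((1 + lam1) * (1 + lam2)) \<le> op_norm vec_norm2 P"
  proof -
    \<comment> \<open>The number 1 separates the claimed constant from the (0, 0) entry of the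
      inverse.\<close>
    have "(1 - lam1) * (1 - lam2) \<le> 1 * 1" using lam1 lam2 by (intro mult_mono) auto
    also have "\<dots> \<le> (1 + lam1) * (1 + lam2)" using lam1 lam2 by (intro mult_mono) auto
    finally have "(1 - lam1) * (1 - lam2) / ((1 + lam1) * (1 + lam2)) \<le> 1"
      using lam1 lam2 by (simp add: divide_le_eq)
    also have "1 \<le> P2 $$ (0, 0) * P1 $$ (0, 0)"
      unfolding P1_def P2_def
      using mult_mono[OF wass_inv_00_ge_1[OF lam2 m] wass_inv_00_ge_1[OF lam1 n]]
        wass_inv_00_ge_1[OF lam2 m] by simp
    also have "\<dots> \<le> op_norm vec_norm2 P"
      using abs_entry_le_op_norm2[OF P N N] P00 by linarith
    finally show ?thesis .
  qed
  have viii2: "op_norm vec_norm2 P \<le> ?k"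
  proof (rule op_norm2_le)
    show "l2_bound P ?k"
      unfolding k_eq P_def using wass_inv_l2_bound lam1 lam2
      by (intro l2_bound_kronecker[OF P2 P1]) (auto simp: P1_def P2_def)
  qed (use P N lam1 lam2 in auto)
  have P_inf: "op_norm vec_norm_inf P \<le> ?k"
    unfolding k_eq
  proof (rule op_norm_inf_le[OF P N])
    fix i assume i: "i < m * n"
    have "(\<Sum>j<m * n. \<bar>P $$ (i, j)\<bar>)
        = (\<Sum>a<m. \<bar>P2 $$ (i div n, a)\<bar>) * (\<Sum>b<n. \<bar>P1 $$ (i mod n, b)\<bar>)"
      unfolding P_def by (rule kronecker_row_sum_abs[OF P2 P1 i])
    also have "\<dots> \<le> (1 + lam2) / (1 - lam2) * ((1 + lam1) / (1 - lam1))"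
      unfolding P1_def P2_def using i lam1 lam2 n
      by (intro mult_mono wass_inv_row_sum_abs_le)
        (auto simp: less_mult_imp_div_less intro: sum_nonneg)
    finally show "(\<Sum>j<m * n. \<bar>P $$ (i, j)\<bar>) \<le> \<dots>" .
  qed

  \<comment> \<open>Condition numbers\<close>
  have ix_eq: "cond_num vec_norm1 Q = cond_num vec_norm_inf Q"
    by (simp add: cond_num_def invQ v2 vii1)
  have w_nonneg: "0 \<le> ?w" using lam1 lam2 by simp
  have ix1: "(1 - lam1) * (1 - lam2)
        / ((1 + lam1) ^ 3 * (1 + lam2) ^ 3 * (1 - lam1 ^ n)\<^sup>2 * (1 - lam2 ^ m)\<^sup>2)
        \<le> cond_num vec_norm1 Q"
  proof -
    \<comment> \<open>The cubes combine the squares in the bound for \<open>Q\<close> with one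
      factor each from the bound for the inverse.\<close>
    have "(1 - lam1) * (1 - lam2)
        / ((1 + lam1) ^ 3 * (1 + lam2) ^ 3 * (1 - lam1 ^ n)\<^sup>2 * (1 - lam2 ^ m)\<^sup>2)
        = 1 / ((1 + lam1)\<^sup>2 * (1 + lam2)\<^sup>2) * ?w"
      by (simp add: power3_eq_cube power2_eq_square mult_ac)
    also have "\<dots> \<le> cond_num vec_norm1 Q"
      unfolding cond_num_def invQ vii1
    proof (rule mult_mono[OF v1 vii2 _ w_nonneg])
      have "0 \<le> 1 / ((1 + lam1)\<^sup>2 * (1 + lam2)\<^sup>2)" by simp
      then show "0 \<le> op_norm vec_norm1 Q" using v1 by linarith
    qed
    finally show ?thesis .
  qed
  have ix2: "cond_num vec_norm_inf Q \<le>
          (1 + lam1) * (1 + lam2) * (1 - lam1 + 2 * lam1 * (1 - lam1 ^ (n - 1)))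
            * (1 - lam2 + 2 * lam2 * (1 - lam2 ^ (m - 1)))
          / ((1 - lam1)\<^sup>2 * (1 - lam2)\<^sup>2)"
  proof -
    have "cond_num vec_norm_inf Q \<le> (r1 * r2) * ?k"
      unfolding cond_num_def invQ
    proof (rule mult_mono[OF v3 P_inf])
      show "0 \<le> op_norm vec_norm_inf P" using vii2 w_nonneg by linarith
      \<comment> \<open>Nonnegativity of the upper bound is inherited from the norm below it, which
        dominates an absolute value.\<close>
      have "0 \<le> \<bar>Q $$ (0, 0)\<bar>" by simp
      also have "\<dots> \<le> r1 * r2" using abs_entry_le_op_norm_inf[OF Q N N] v3 by linarith
      finally show "0 \<le> r1 * r2" .
    qed
    also have "r1 = (1 - lam1 + 2 * lam1 * (1 - lam1 ^ (n - 1))) / (1 - lam1)"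
      using lam1 by (simp add: r1_def add_divide_distrib)
    also have "r2 = (1 - lam2 + 2 * lam2 * (1 - lam2 ^ (m - 1))) / (1 - lam2)"
      using lam2 by (simp add: r2_def add_divide_distrib)
    finally show ?thesis by (simp add: power2_eq_square mult_ac)
  qed

  have x1: "(1 - lam1) * (1 - lam2) / ((1 + lam1) ^ 3 * (1 + lam2) ^ 3) \<le> cond_num vec_norm2 Q"
  proof -
    have "(1 - lam1) * (1 - lam2) / ((1 + lam1) ^ 3 * (1 + lam2) ^ 3)
        = 1 / ((1 + lam1)\<^sup>2 * (1 + lam2)\<^sup>2) * ((1 - lam1) * (1 - lam2) / ((1 + lam1) * (1 + lam2)))"
      by (simp add: power3_eq_cube power2_eq_square mult_ac)
    also have "\<dots> \<le> cond_num vec_norm2 Q"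
      unfolding cond_num_def invQ
      using lam1 lam2 Q N by (intro mult_mono vi1 viii1 op_norm2_nonneg) auto
    finally show ?thesis .
  qed
  have x2: "cond_num vec_norm2 Q \<le> m1 * m2 * ?k"
    unfolding cond_num_def invQ
  proof (rule mult_mono[OF vi2 viii2])
    have "0 \<le> op_norm vec_norm2 Q" "0 \<le> op_norm vec_norm2 P"
      using Q P N by (auto intro: op_norm2_nonneg)
    then show "0 \<le> m1 * m2" "0 \<le> op_norm vec_norm2 P" using vi2 by auto
  qed

  show ?thesis
    unfolding invQ
    using i ii iii iv v1 v2 v3[unfolded r1_def r2_def] vi1 vi2 vii1 vii2 viii1 viii2
      ix1 ix_eq ix2 x1 x2
    by blast
qed

end
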